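(* Let $\Gamma$ be a finite simplicial connected graph with at least two vertices. Let $p:A_\Gamma\to\mathbb{Z}$ be an arbitrary group homomorphism from the right-angled Artin group $A_\Gamma$ and let $N$ be the kernel of $p$. Let $\Gamma'$ be the induced subgraph of $\Gamma$ on the vertices which are mapped to nonzero numbers in $\mathbb{Z}$ by $p$. If the graph $\Gamma'$ is connected and the star of $\Gamma'$ in $\Gamma$ contains all vertices of $\Gamma$, then the subgroup $N$ is finitely generated and the distortion of $N$ in $A_\Gamma$ is at most quadratic. Moreover, if each vertex of $\Gamma$ is mapped to a nonzero number in $\mathbb{Z}$, then the distortion of $N$ in $A_\Gamma$ is linear when $\Gamma$ is a join and is quadratic otherwise.
   Context: For a finite simplicial graph $\Gamma$, the right-angled Artin group $A_\Gamma$ has generating set the vertices of $\Gamma$ and relations $st=ts$ whenever $s$ and $t$ are adjacent vertices. The star of $\Gamma'$ in $\Gamma$ contains a vertex $v$ of $\Gamma$ exactly when $v$ lies in $\Gamma'$ or is adjacent to a vertex of $\Gamma'$. The join of two graphs is obtained by connecting every vertex of the first to every vertex of the second by an edge; a graph is a join if it is the join of two (nonempty) subgraphs. For functions $f,g$ from $[0,\infty)$ to $[0,\infty]$ (only values at large arguments matter, so functions on $(0,\infty)$ are allowed), $f\preceq g$ ($f$ is dominated by $g$) if there are positive constants $A,B,C,D$ such that $f(x)\le A\,g(Bx)+Cx$ for all $x>D$; $f\sim g$ means $f\preceq g$ and $g\preceq f$. A function is linear (respectively quadratic) if it is equivalent ($\sim$) to a polynomial of degree one (respectively two), and at most quadratic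 if it is dominated by a quadratic function. Let $G$ be a group with finite generating set $S$ and $H$ a subgroup with finite generating set $T$; $|\cdot|_S$ and $|\cdot|_T$ are the word lengths. The subgroup distortion of $H$ in $G$ is $Dist_G^H(r)=\max\{|h|_T : h\in H,\ |h|_S\le r\}$ for $r>0$; up to $\sim$ it does not depend on $S$ and $T$. *)

theory Defs
  imports
    "HOL-Algebra.Elementary_Groups"
    "HOL-Algebra.Generated_Groups"
    "HOL-Computational_Algebra.Polynomial"
    "HOL-Library.Extended_Nonnegative_Real"
    "Graph_Theory.Graph_Theory"
begin

section \<open>Groups given by generators and relations\<close>

text \<open>The letter \<open>(x, True)\<close> stands for the generator \<open>x\<close> and \<open>(x, False)\<close> for its formal inverse.\<close>

type_synonym 'a gword = "('a \<times> bool) list"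

definition gwords :: "'a set \<Rightarrow> 'a gword set" where
  "gwords X = lists (X \<times> UNIV)"

text \<open>A relation \<open>r = s\<close> between two words is given by the pair \<open>(r, s)\<close>.\<close>

inductive_set pres_cong :: "'a set \<Rightarrow> ('a gword \<times> 'a gword) set \<Rightarrow> ('a gword \<times> 'a gword) set"
  for X R where
    refl: "w \<in> gwords X \<Longrightarrow> (w, w) \<in> pres_cong X R"
  | sym: "(v, w) \<in> pres_cong X R \<Longrightarrow> (w, v) \<in> pres_cong X R"
  | trans: "(u, v) \<in> pres_cong X R \<Longrightarrow> (v, w) \<in> pres_cong X R \<Longrightarrow> (u, w) \<in> pres_cong X R"
  | cancel: "u \<in> gwords X \<Longrightarrow> v \<in> gwords X \<Longrightarrow> x \<in> X \<Longrightarrow>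
      (u @ [(x, b), (x, \<not> b)] @ v, u @ v) \<in> pres_cong X R"
  | rel: "u \<in> gwords X \<Longrightarrow> v \<in> gwords X \<Longrightarrow> (r, s) \<in> R \<Longrightarrow> r \<in> gwords X \<Longrightarrow> s \<in> gwords X \<Longrightarrow>
      (u @ r @ v, u @ s @ v) \<in> pres_cong X R"

definition presented_group :: "'a set \<Rightarrow> ('a gword \<times> 'a gword) set \<Rightarrow> 'a gword set monoid" where
  "presented_group X R =
    \<lparr>carrier = gwords X // pres_cong X R,
     monoid.mult = (\<lambda>A B. \<Union>a\<in>A. \<Union>b\<in>B. pres_cong X R `` {a @ b}),
     one = pres_cong X R `` {[]}\<rparr>"

lemma pres_cong_gwords:
  "(v, w) \<in> pres_cong X R \<Longrightarrow> v \<in> gwords X \<and> w \<in> gwords X"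
  by (induction rule: pres_cong.induct) (auto simp: gwords_def)

lemma equiv_pres_cong: "equiv (gwords X) (pres_cong X R)"
proof (rule equivI)
  show "pres_cong X R \<subseteq> gwords X \<times> gwords X"
    using pres_cong_gwords by fast
  show "refl_on (gwords X) (pres_cong X R)"
    by (auto intro: refl_onI pres_cong.refl)
  show "sym_on UNIV (pres_cong X R)"
    by (auto intro: symI pres_cong.sym)
  show "trans_on UNIV (pres_cong X R)"
    by (rule transI) (rule pres_cong.trans)
qed

lemma pres_cong_context:
  assumes "(v, w) \<in> pres_cong X R" "a \<in> gwords X" "b \<in> gwords X"
  shows "(a @ v @ b, a @ w @ b) \<in> pres_cong X R"
  using assms
proof (induction rule: pres_cong.induct)
  case (refl w)
  then show ?case by (intro pres_cong.refl) (auto simp: gwords_def)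
next
  case (cancel u v x c)
  then show ?case
    using pres_cong.cancel[of "a @ u" X "v @ b" x c R] by (auto simp: gwords_def)
next
  case (rel u v r s)
  then show ?case
    using pres_cong.rel[of "a @ u" X "v @ b" r s R] by (auto simp: gwords_def)
next
  case (sym v w)
  then show ?case by (simp add: pres_cong.sym)
next
  case (trans u v w)
  show ?case by (rule pres_cong.trans[OF trans.IH]) (use trans.prems in simp_all)
qed

lemma pres_cong_append:
  assumes "(v, v') \<in> pres_cong X R" "(w, w') \<in> pres_cong X R"
  shows "(v @ w, v' @ w') \<in> pres_cong X R"
proof -
  have "(v @ w, v' @ w) \<in> pres_cong X R"
    using pres_cong_context[OF assms(1), of "[]" w] pres_cong_gwords[OF assms(2)]
    by (auto simp: gwords_def)
  moreover have "(v' @ w, v' @ w') \<in> pres_cong X R"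
    using pres_cong_context[OF assms(2), of v' "[]"] pres_cong_gwords[OF assms(1)]
    by (auto simp: gwords_def)
  ultimately show ?thesis by (rule pres_cong.trans)
qed

lemma presented_group_mult:
  assumes "v \<in> gwords X" "w \<in> gwords X"
  shows "(pres_cong X R `` {v}) \<otimes>\<^bsub>presented_group X R\<^esub> (pres_cong X R `` {w}) = pres_cong X R `` {v @ w}"
proof -
  let ?A = "pres_cong X R `` {v}" and ?B = "pres_cong X R `` {w}" and ?C = "pres_cong X R `` {v @ w}"
  have C: "pres_cong X R `` {a @ b} = ?C" if "a \<in> ?A" "b \<in> ?B" for a b
  proof -
    have "(v @ w, a @ b) \<in> pres_cong X R"
      using that by (intro pres_cong_append) auto
    then show ?thesis by (rule equiv_class_eq[OF equiv_pres_cong, symmetric])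
  qed
  have ne: "?A \<noteq> {}" "?B \<noteq> {}"
    using assms by (auto intro: pres_cong.refl)
  have "(\<Union>a\<in>?A. \<Union>b\<in>?B. pres_cong X R `` {a @ b}) = (\<Union>a\<in>?A. \<Union>b\<in>?B. ?C)"
    by (intro SUP_cong HOL.refl C)
  also have "\<dots> = ?C"
    using ne by (simp only: UN_constant if_False)
  finally show ?thesis by (simp only: presented_group_def monoid.simps)
qed

definition gword_inv :: "'a gword \<Rightarrow> 'a gword" where
  "gword_inv w = rev (map (\<lambda>(x, b). (x, \<not> b)) w)"

lemma gword_inv_gwords: "w \<in> gwords X \<Longrightarrow> gword_inv w \<in> gwords X"
  by (auto simp: gwords_def gword_inv_def)

lemma gword_inv_cancel:
  "w \<in> gwords X \<Longrightarrow> (gword_inv w @ w, []) \<in> pres_cong X R"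
proof (induction w)
  case Nil
  then show ?case by (auto simp: gword_inv_def intro!: pres_cong.refl)
next
  case (Cons l w)
  obtain x b where l: "l = (x, b)" by (cases l)
  have *: "x \<in> X" "w \<in> gwords X" using Cons.prems by (auto simp: gwords_def l)
  have "gword_inv (l # w) @ l # w = gword_inv w @ [(x, \<not> b), (x, \<not> \<not> b)] @ w"
    by (simp add: gword_inv_def l)
  moreover have "(gword_inv w @ [(x, \<not> b), (x, \<not> \<not> b)] @ w, gword_inv w @ w) \<in> pres_cong X R"
    using * by (intro pres_cong.cancel gword_inv_gwords)
  ultimately show ?case using Cons.IH[OF *(2)] by (metis pres_cong.trans)
qed

lemma group_presented_group: "group (presented_group X R)"
proof -
  let ?G = "presented_group X R"
  have carrier: "carrier ?G = (\<lambda>w. pres_cong X R `` {w}) ` gwords X"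
    by (auto simp: presented_group_def quotient_def)
  have one: "\<one>\<^bsub>?G\<^esub> = pres_cong X R `` {[]}"
    by (simp add: presented_group_def)
  have nil: "[] \<in> gwords X" by (simp add: gwords_def)
  have app: "v @ w \<in> gwords X" if "v \<in> gwords X" "w \<in> gwords X" for v w
    using that by (auto simp: gwords_def)
  show ?thesis
  proof (rule groupI)
    fix a assume "a \<in> carrier ?G"
    then obtain w where w: "w \<in> gwords X" "a = pres_cong X R `` {w}"
      by (auto simp: carrier)
    have "pres_cong X R `` {gword_inv w} \<otimes>\<^bsub>?G\<^esub> a = \<one>\<^bsub>?G\<^esub>"
      using w equiv_class_eq[OF equiv_pres_cong gword_inv_cancel[OF w(1)]]
      by (simp add: presented_group_mult gword_inv_gwords one)
    then show "\<exists>b\<in>carrier ?G. b \<otimes>\<^bsub>?G\<^esub> a = \<one>\<^bsub>?G\<^esub>"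
      using w by (auto simp: carrier gword_inv_gwords)
  qed (auto simp: carrier one nil app presented_group_mult)
qed

section \<open>Right-angled Artin groups\<close>

text \<open>Finite simplicial graphs are the finite, symmetric, loop-free digraphs without parallel arcs,
  \<^locale>\<open>pair_graph\<close>; an edge is a pair of opposite arcs.\<close>

definition raag :: "'a pair_pre_digraph \<Rightarrow> 'a gword set monoid" where
  "raag G = presented_group (pverts G)
     {([(s, True), (t, True)], [(t, True), (s, True)]) | s t. (s, t) \<in> parcs G}"

definition raag_gen :: "'a pair_pre_digraph \<Rightarrow> 'a \<Rightarrow> 'a gword set" where
  "raag_gen G v = pres_cong (pverts G)
     {([(s, True), (t, True)], [(t, True), (s, True)]) | s t. (s, t) \<in> parcs G} `` {[(v, True)]}"

lemma group_raag: "group (raag G)"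
  unfolding raag_def by (rule group_presented_group)

lemma raag_gen_closed: "v \<in> pverts G \<Longrightarrow> raag_gen G v \<in> carrier (raag G)"
  by (auto simp: raag_gen_def raag_def presented_group_def gwords_def intro!: quotientI)

lemma raag_gen_commute:
  assumes "pair_graph G" "(s, t) \<in> parcs G"
  shows "raag_gen G s \<otimes>\<^bsub>raag G\<^esub> raag_gen G t = raag_gen G t \<otimes>\<^bsub>raag G\<^esub> raag_gen G s"
proof -
  interpret pair_graph G by fact
  have v: "s \<in> pverts G" "t \<in> pverts G" using assms(2) wellformed' by blast+
  let ?R = "{([(s, True), (t, True)], [(t, True), (s, True)]) | s t. (s, t) \<in> parcs G}"
  have "([] @ [(s, True), (t, True)] @ [], [] @ [(t, True), (s, True)] @ [])
      \<in> pres_cong (pverts G) ?R"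
    using assms(2) v by (intro pres_cong.rel) (auto simp: gwords_def)
  from equiv_class_eq[OF equiv_pres_cong this] show ?thesis
    using v by (simp add: raag_gen_def raag_def presented_group_mult gwords_def)
qed

section \<open>Stars and joins\<close>

definition star :: "('a, 'b) pre_digraph \<Rightarrow> ('a, 'b) pre_digraph \<Rightarrow> 'a set" where
  "star H G = {v \<in> verts G. v \<in> verts H \<or> (\<exists>w\<in>verts H. v \<rightarrow>\<^bsub>G\<^esub> w)}"

definition graph_join :: "'a pair_pre_digraph \<Rightarrow> 'a pair_pre_digraph \<Rightarrow> 'a pair_pre_digraph" where
  "graph_join G H =
    \<lparr>pverts = pverts G \<union> pverts H,
     parcs = parcs G \<union> parcs H \<union> pverts G \<times> pverts H \<union> pverts H \<times> pverts G\<rparr>"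

definition is_join :: "'a pair_pre_digraph \<Rightarrow> bool" where
  "is_join G \<longleftrightarrow> (\<exists>G1 G2. pair_graph G1 \<and> pair_graph G2 \<and> subgraph G1 G \<and> subgraph G2 G \<and>
     pverts G1 \<noteq> {} \<and> pverts G2 \<noteq> {} \<and> pverts G1 \<inter> pverts G2 = {} \<and> G = graph_join G1 G2)"

section \<open>Comparison of growth\<close>

definition dominated :: "(real \<Rightarrow> ennreal) \<Rightarrow> (real \<Rightarrow> ennreal) \<Rightarrow> bool" where
  "dominated f g \<longleftrightarrow> (\<exists>A>0. \<exists>B>0. \<exists>C>0. \<exists>D>0. \<forall>x>D.
     f x \<le> ennreal A * g (B * x) + ennreal (C * x))"

definition growth_equiv :: "(real \<Rightarrow> ennreal) \<Rightarrow> (real \<Rightarrow> ennreal) \<Rightarrow> bool" where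
  "growth_equiv f g \<longleftrightarrow> dominated f g \<and> dominated g f"

text \<open>The functions compared take values in \<open>[0, \<infinity>]\<close>, so only polynomials that are nonnegative
  for large arguments count; without this condition \<open>ennreal\<close> would truncate a polynomial with
  negative leading coefficient to 0.\<close>

definition polynomial_growth :: "nat \<Rightarrow> (real \<Rightarrow> ennreal) \<Rightarrow> bool" where
  "polynomial_growth d f \<longleftrightarrow> (\<exists>q :: real poly. degree q = d \<and> (\<forall>\<^sub>F x in at_top. 0 \<le> poly q x) \<and>
     growth_equiv f (\<lambda>x. ennreal (poly q x)))"

definition linear_growth :: "(real \<Rightarrow> ennreal) \<Rightarrow> bool" where
  "linear_growth f \<longleftrightarrow> polynomial_growth 1 f"

definition quadratic_growth :: "(real \<Rightarrow> ennreal) \<Rightarrow> bool" where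
  "quadratic_growth f \<longleftrightarrow> polynomial_growth 2 f"

definition at_most_quadratic_growth :: "(real \<Rightarrow> ennreal) \<Rightarrow> bool" where
  "at_most_quadratic_growth f \<longleftrightarrow> (\<exists>g. quadratic_growth g \<and> dominated f g)"

section \<open>Subgroup distortion\<close>

definition finite_gen_set :: "('g, 'm) monoid_scheme \<Rightarrow> 'g set \<Rightarrow> 'g set \<Rightarrow> bool" where
  "finite_gen_set G H T \<longleftrightarrow> finite T \<and> T \<subseteq> H \<and> generate G T = H"

definition word_length :: "('g, 'm) monoid_scheme \<Rightarrow> 'g set \<Rightarrow> 'g \<Rightarrow> nat" where
  "word_length G S g = (LEAST n. \<exists>ws. length ws = n \<and> set ws \<subseteq> S \<union> m_inv G ` S \<and>
     foldr (monoid.mult G) ws \<one>\<^bsub>G\<^esub> = g)"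

text \<open>If \<open>S\<close> is a finite generating set of \<open>G\<close>, the maximum is over a finite set, which for
  \<open>r \<ge> 0\<close> is nonempty.\<close>

definition distortion ::
  "('g, 'm) monoid_scheme \<Rightarrow> 'g set \<Rightarrow> 'g set \<Rightarrow> 'g set \<Rightarrow> real \<Rightarrow> ennreal" where
  "distortion G S H T r =
     of_nat (Max {word_length G T h | h. h \<in> H \<and> real (word_length G S h) \<le> r})"

end

theory Submission
  imports Defs "HOL-Library.Sublist"
begin

text \<open>Upper bounds. Choose powers \<open>\<tau>\<^sub>v\<close> of the generators outside the kernel with the same image \<open>m\<close>
  under \<open>p\<close>, and let \<open>t\<close> be one of them. Schreier rewriting writes a kernel element of length \<open>r\<close> as a
  product of \<open>r\<close> conjugates \<open>t\<^sup>q y t\<^sup>-\<^sup>q\<close>, with \<open>q = O(r)\<close> and \<open>y\<close> in a finite part of the kernel.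
  Along a path in \<open>\<Gamma>'\<close> the power \<open>t\<^sup>q\<close> turns into \<open>\<tau>\<^sub>v\<^sup>q\<close> up to a kernel element of length
  \<open>O(q)\<close>, and some \<open>\<tau>\<^sub>v\<close> commutes with any given generator; so each conjugate costs only \<open>O(q)\<close>
  kernel generators. In a join the two factors can compensate each other's image under \<open>p\<close> by
  elements that commute with them, and no conjugation is needed.

  Lower bound. If \<open>\<Gamma>\<close> is not a join, its complement is connected and a closed walk in the complement
  visits all vertices. Its powers cross pairwise nested walls of the group, which every path to the
  endpoint crosses in the same order. At the crossing of a wall labelled \<open>v\<close> the exponent of
  \<open>v\<close> is determined. A path in the kernel stays at bounded height, so in the \<open>i\<close>-th period it
  must change some exponent by about \<open>i\<close>; summing over \<open>i\<close> gives a quadratic length.\<close>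

section \<open>Word metrics\<close>

text \<open>Two difficulties shape the constants. Conjugation changes kernel elements, so their cost
  is measured by two numbers: a bound \<open>L\<close> on the letters, in the metric of the whole
  group, and the number \<open>k\<close> of letters. Conjugation by a fixed element raises only
  \<open>L\<close>. Every estimate keeps \<open>L\<close> independent of the length under
  consideration, and the ball of radius \<open>L\<close> in the kernel finally serves as its
  generating set; so finite generation comes out of the length bound.

  For the lower bound, all spellings of an element have to be controlled at once. This is why walls
  are read off from pilings, which depend only on the group element. The letters of the walk carry
  signs that make their images under \<open>p\<close> positive; then the signed exponents can all be
  large only at large height. A word over a finite subset of the kernel returns to height zero after
  each of its letters, so its spelling stays below a fixed height. A final power of one vertex
  brings the endpoint of the walk into the kernel without leaving the half-spaces already
  entered.\<close>

context group
begin

definition lprod :: "'a list \<Rightarrow> 'a" where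
  "lprod ws = foldr (\<otimes>) ws \<one>"

text \<open>\<open>word_length\<close> is a \<open>LEAST\<close> and says nothing useful outside the
  generated subgroup. Balls avoid this and turn length estimates into plain membership;
  \<open>word_length_le_iff\<close> translates back.\<close>

definition word_ball :: "'a set \<Rightarrow> nat \<Rightarrow> 'a set" where
  "word_ball S n = {lprod ws | ws. length ws \<le> n \<and> set ws \<subseteq> S \<union> m_inv G ` S}"

lemma lprod_simps [simp]: "lprod [] = \<one>" "lprod (x # ws) = x \<otimes> lprod ws"
  by (auto simp: lprod_def)

lemma lprod_closed [simp]: "set ws \<subseteq> carrier G \<Longrightarrow> lprod ws \<in> carrier G"
  by (induction ws) auto

lemma lprod_append [simp]:
  "set ws \<subseteq> carrier G \<Longrightarrow> set vs \<subseteq> carrier G \<Longrightarrow> lprod (ws @ vs) = lprod ws \<otimes> lprod vs"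
  by (induction ws) (auto simp: m_assoc)

lemma letters_closed: "S \<subseteq> carrier G \<Longrightarrow> S \<union> m_inv G ` S \<subseteq> carrier G"
  by auto

lemma inv_lprod:
  "set ws \<subseteq> carrier G \<Longrightarrow> inv (lprod ws) = lprod (rev (map (m_inv G) ws))"
proof (induction ws)
  case (Cons x ws)
  then have "set (rev (map (m_inv G) ws)) \<subseteq> carrier G" by auto
  then show ?case using Cons by (simp add: inv_mult_group)
qed simp

lemma inv_letter:
  assumes "S \<subseteq> carrier G" "x \<in> S \<union> m_inv G ` S"
  shows "inv x \<in> S \<union> m_inv G ` S"
  using assms by auto

lemma word_ballE:
  assumes "g \<in> word_ball S n"
  obtains ws where "g = lprod ws" "length ws \<le> n" "set ws \<subseteq> S \<union> m_inv G ` S"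
  using assms by (auto simp: word_ball_def)

lemma word_ballI:
  "length ws \<le> n \<Longrightarrow> set ws \<subseteq> S \<union> m_inv G ` S \<Longrightarrow> lprod ws \<in> word_ball S n"
  by (auto simp: word_ball_def)

lemma word_ball_closed: "S \<subseteq> carrier G \<Longrightarrow> word_ball S n \<subseteq> carrier G"
proof
  fix g
  assume S: "S \<subseteq> carrier G" and "g \<in> word_ball S n"
  then obtain ws where "g = lprod ws" "set ws \<subseteq> S \<union> m_inv G ` S" by (elim word_ballE)
  then show "g \<in> carrier G" using lprod_closed[OF order_trans[OF _ letters_closed[OF S]]] by simp
qed

lemma word_ball_mono: "S \<subseteq> S' \<Longrightarrow> n \<le> n' \<Longrightarrow> word_ball S n \<subseteq> word_ball S' n'"
proof
  fix g
  assume "S \<subseteq> S'" "n \<le> n'" "g \<in> word_ball S n"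
  then show "g \<in> word_ball S' n'"
    by (elim word_ballE) (auto intro!: word_ballI)
qed

lemma one_word_ball [simp]: "\<one> \<in> word_ball S n"
  using word_ballI[of "[]"] by simp

lemma incl_word_ball: "S \<subseteq> carrier G \<Longrightarrow> x \<in> S \<union> m_inv G ` S \<Longrightarrow> 1 \<le> n \<Longrightarrow> x \<in> word_ball S n"
  using word_ballI[of "[x]" n S] by auto

lemma mult_word_ball:
  assumes "S \<subseteq> carrier G" "g \<in> word_ball S m" "h \<in> word_ball S n"
  shows "g \<otimes> h \<in> word_ball S (m + n)"
proof -
  obtain ws where ws: "g = lprod ws" "length ws \<le> m" "set ws \<subseteq> S \<union> m_inv G ` S"
    using assms(2) by (rule word_ballE)
  obtain vs where vs: "h = lprod vs" "length vs \<le> n" "set vs \<subseteq> S \<union> m_inv G ` S"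
    using assms(3) by (rule word_ballE)
  have "g \<otimes> h = lprod (ws @ vs)"
    using ws vs letters_closed[OF assms(1)] by (subst lprod_append) auto
  then show ?thesis using ws vs word_ballI[of "ws @ vs" "m + n" S] by simp
qed

lemma inv_word_ball:
  assumes "S \<subseteq> carrier G" "g \<in> word_ball S n"
  shows "inv g \<in> word_ball S n"
proof -
  obtain ws where ws: "g = lprod ws" "length ws \<le> n" "set ws \<subseteq> S \<union> m_inv G ` S"
    using assms(2) by (rule word_ballE)
  have "inv g = lprod (rev (map (m_inv G) ws))"
    using ws letters_closed[OF assms(1)] by (subst ws(1), subst inv_lprod) auto
  moreover have "set (rev (map (m_inv G) ws)) \<subseteq> S \<union> m_inv G ` S"
    using ws inv_letter[OF assms(1)] by auto
  ultimately show ?thesis using ws word_ballI[of "rev (map (m_inv G) ws)" n S] by simp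
qed

lemma nat_pow_word_ball:
  assumes "S \<subseteq> carrier G" "g \<in> word_ball S n"
  shows "g [^] (k::nat) \<in> word_ball S (n * k)"
proof (induction k)
  case (Suc k)
  then show ?case using mult_word_ball[OF assms(1) Suc assms(2)] by (simp add: add.commute)
qed simp

lemma int_pow_word_ball:
  assumes "S \<subseteq> carrier G" "g \<in> word_ball S n"
  shows "g [^] (k::int) \<in> word_ball S (n * nat \<bar>k\<bar>)"
proof (cases "k < 0")
  case True
  then have "g [^] k = inv (g [^] nat \<bar>k\<bar>)" by (subst int_pow_def2) simp
  also have "\<dots> \<in> word_ball S (n * nat \<bar>k\<bar>)"
    by (rule inv_word_ball[OF assms(1) nat_pow_word_ball[OF assms]])
  finally show ?thesis .
next
  case False
  then have "g [^] k = g [^] nat \<bar>k\<bar>" by (subst int_pow_def2) simp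
  also have "\<dots> \<in> word_ball S (n * nat \<bar>k\<bar>)" by (rule nat_pow_word_ball[OF assms])
  finally show ?thesis .
qed

lemma lprod_word_ball:
  assumes "S \<subseteq> carrier G" "set ws \<subseteq> word_ball S k"
  shows "lprod ws \<in> word_ball S (k * length ws)"
  using assms(2)
proof (induction ws)
  case (Cons x ws)
  then show ?case using mult_word_ball[OF assms(1), of x k "lprod ws" "k * length ws"] by simp
qed simp

lemma word_ball_word_ball:
  assumes "S \<subseteq> carrier G" "S' \<subseteq> word_ball S k"
  shows "word_ball S' n \<subseteq> word_ball S (k * n)"
proof
  fix g assume "g \<in> word_ball S' n"
  then obtain ws where ws: "g = lprod ws" "length ws \<le> n" "set ws \<subseteq> S' \<union> m_inv G ` S'"
    by (rule word_ballE)
  have "x \<in> word_ball S k" if "x \<in> S' \<union> m_inv G ` S'" for x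
    using that inv_word_ball[OF assms(1)] assms(2) by blast
  then have "set ws \<subseteq> word_ball S k" using ws(3) by blast
  from lprod_word_ball[OF assms(1) this] show "g \<in> word_ball S (k * n)"
    using word_ball_mono[of S S "k * length ws" "k * n"] ws by auto
qed

lemma finite_word_ball: "finite S \<Longrightarrow> finite (word_ball S n)"
proof -
  assume "finite S"
  then have "finite {ws. set ws \<subseteq> S \<union> m_inv G ` S \<and> length ws \<le> n}"
    by (intro finite_lists_length_le) auto
  then have "finite (lprod ` {ws. set ws \<subseteq> S \<union> m_inv G ` S \<and> length ws \<le> n})" by simp
  then show ?thesis by (rule rev_finite_subset) (auto simp: word_ball_def)
qed

lemma generate_eq_word_balls:
  assumes "S \<subseteq> carrier G"
  shows "generate G S = (\<Union>n. word_ball S n)"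
proof
  show "generate G S \<subseteq> (\<Union>n. word_ball S n)"
  proof
    fix g assume "g \<in> generate G S"
    then show "g \<in> (\<Union>n. word_ball S n)"
    proof (induction rule: generate.induct)
      case (incl h) then show ?case using incl_word_ball[OF assms, of h 1] by auto
    next
      case (inv h) then show ?case using incl_word_ball[OF assms, of "inv h" 1] by auto
    next
      case (eng h1 h2) then show ?case using mult_word_ball[OF assms] by blast
    qed auto
  qed
  show "(\<Union>n. word_ball S n) \<subseteq> generate G S"
  proof
    fix g assume "g \<in> (\<Union>n. word_ball S n)"
    then obtain ws where ws: "g = lprod ws" "set ws \<subseteq> S \<union> m_inv G ` S"
      by (auto elim: word_ballE)
    have "lprod ws \<in> generate G S" using ws(2)
    proof (induction ws)
      case (Cons x ws)
      then have "x \<in> generate G S" by (auto intro: generate.incl generate.inv)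
      then show ?case using Cons by (auto intro: generate.eng)
    qed (auto intro: generate.one)
    then show "g \<in> generate G S" using ws by simp
  qed
qed

lemma word_length_le_iff:
  assumes "S \<subseteq> carrier G" "g \<in> generate G S"
  shows "word_length G S g \<le> n \<longleftrightarrow> g \<in> word_ball S n"
proof -
  let ?P = "\<lambda>n. \<exists>ws. length ws = n \<and> set ws \<subseteq> S \<union> m_inv G ` S \<and> lprod ws = g"
  have wl: "word_length G S g = (LEAST n. ?P n)" by (simp add: word_length_def lprod_def)
  obtain k where "g \<in> word_ball S k" using assms generate_eq_word_balls by auto
  then have "\<exists>n. ?P n" by (auto elim: word_ballE)
  then have "?P (word_length G S g)" unfolding wl by (rule LeastI_ex)
  moreover have "word_length G S g \<le> n" if "?P n" for n
    unfolding wl using that by (rule Least_le)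
  ultimately show ?thesis by (fastforce simp: word_ball_def)
qed

text \<open>\<open>k\<close> bounds the lengths of finitely many words over \<open>S\<close> that
  spell \<open>S'\<close>. Estimates proved for one pair of generating sets therefore pass to all
  others.\<close>

lemma word_ball_change_generators:
  assumes "S \<subseteq> carrier G" "finite S'" "S' \<subseteq> generate G S"
  obtains k where "\<And>n. word_ball S' n \<subseteq> word_ball S (k * n)"
proof -
  have "\<forall>s\<in>S'. \<exists>n. s \<in> word_ball S n"
    using assms generate_eq_word_balls by blast
  then obtain f where f: "\<And>s. s \<in> S' \<Longrightarrow> s \<in> word_ball S (f s)" by metis
  have "S' \<subseteq> word_ball S (Max (f ` S'))"
  proof
    fix s assume "s \<in> S'"
    then have "f s \<le> Max (f ` S')" using assms(2) by simp
    then show "s \<in> word_ball S (Max (f ` S'))"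
      using subsetD[OF word_ball_mono[OF order_refl] f[OF \<open>s \<in> S'\<close>]] by simp
  qed
  then show ?thesis by (intro that word_ball_word_ball[OF assms(1)])
qed

lemma finite_subset_word_ball:
  assumes "S \<subseteq> carrier G" "finite F" "F \<subseteq> generate G S"
  obtains n where "F \<subseteq> word_ball S n"
proof -
  obtain k where "\<And>n. word_ball F n \<subseteq> word_ball S (k * n)"
    using word_ball_change_generators[OF assms] by blast
  moreover have "F \<subseteq> word_ball F 1"
    using incl_word_ball[of F _ 1] generate_in_carrier[OF assms(1)] assms(3) by auto
  ultimately show ?thesis using that by blast
qed

end

section \<open>Distortion up to equivalence\<close>

lemma dominatedI:
  assumes "A > 0" "B > 0" "C > 0" "D > 0"
    and "\<And>x. x > D \<Longrightarrow> f x \<le> ennreal A * g (B * x) + ennreal (C * x)"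
  shows "dominated f g"
  unfolding dominated_def using assms by blast

lemma dominated_refl: "dominated f f"
  by (rule dominatedI[of 1 1 1 1]) auto

locale fg_subgroup = group G for G (structure) +
  fixes S H T
  assumes S: "finite_gen_set G (carrier G) S"
    and T: "finite_gen_set G H T"
    and H: "H \<subseteq> carrier G"
begin

abbreviation lenS where "lenS h \<equiv> word_length G S h"
abbreviation lenT where "lenT h \<equiv> word_length G T h"

lemma S_closed: "S \<subseteq> carrier G" and T_closed: "T \<subseteq> carrier G"
  and finite_S: "finite S" and finite_T: "finite T"
  and generate_S: "generate G S = carrier G" and generate_T: "generate G T = H"
  using S T H by (auto simp: finite_gen_set_def)

lemma one_in_H: "\<one> \<in> H"
  using generate.one[of G T] generate_T by simp

lemma lenS_le_iff: "h \<in> carrier G \<Longrightarrow> lenS h \<le> n \<longleftrightarrow> h \<in> word_ball S n"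
  using word_length_le_iff[OF S_closed] generate_S by simp

lemma lenT_le_iff: "h \<in> H \<Longrightarrow> lenT h \<le> n \<longleftrightarrow> h \<in> word_ball T n"
  using word_length_le_iff[OF T_closed] generate_T by simp

lemma finite_distortion_set: "finite {lenT h | h. h \<in> H \<and> real (lenS h) \<le> r}"
proof -
  have "{h \<in> H. real (lenS h) \<le> r} \<subseteq> word_ball S (nat \<lfloor>r\<rfloor>)"
  proof
    fix h assume h: "h \<in> {h \<in> H. real (lenS h) \<le> r}"
    then have "lenS h \<le> nat \<lfloor>r\<rfloor>" by (auto simp: le_nat_floor)
    then show "h \<in> word_ball S (nat \<lfloor>r\<rfloor>)" using lenS_le_iff h H by auto
  qed
  then have "finite {h \<in> H. real (lenS h) \<le> r}"
    using finite_word_ball[OF finite_S] finite_subset by blast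
  then have "finite (lenT ` {h \<in> H. real (lenS h) \<le> r})" by simp
  then show ?thesis by (rule rev_finite_subset) auto
qed

lemma distortion_ge:
  assumes "h \<in> H" "real (lenS h) \<le> r"
  shows "ennreal (real (lenT h)) \<le> distortion G S H T r"
proof -
  have "lenT h \<le> Max {lenT h | h. h \<in> H \<and> real (lenS h) \<le> r}"
    using assms by (intro Max_ge finite_distortion_set) auto
  then have "(of_nat (lenT h) :: ennreal) \<le> distortion G S H T r"
    unfolding distortion_def by (rule of_nat_mono)
  then show ?thesis by (simp add: ennreal_of_nat_eq_real_of_nat)
qed

lemma distortion_attained:
  assumes "r \<ge> 0"
  obtains h where "h \<in> H" "real (lenS h) \<le> r" "distortion G S H T r = ennreal (real (lenT h))"
proof -
  let ?D = "{lenT h | h. h \<in> H \<and> real (lenS h) \<le> r}"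
  have "\<one> \<in> word_ball S 0" by simp
  then have "lenS \<one> \<le> 0" using lenS_le_iff[of \<one> 0] by simp
  then have "lenT \<one> \<in> ?D" using one_in_H assms by auto
  then have "Max ?D \<in> ?D" by (intro Max_in finite_distortion_set) auto
  then obtain h where "h \<in> H" "real (lenS h) \<le> r" "Max ?D = lenT h" by auto
  then show ?thesis
    using that by (simp add: distortion_def ennreal_of_nat_eq_real_of_nat)
qed

text \<open>The summand \<open>C * x\<close> in \<open>dominated\<close> lets every function
  dominate the identity polynomial, so only the upper bound carries content.\<close>

lemma linear_growth_distortion:
  assumes "\<And>h. h \<in> H \<Longrightarrow> lenT h \<le> C * (lenS h + 1)"
  shows "linear_growth (distortion G S H T)"
proof -
  let ?f = "distortion G S H T"
  \<comment> \<open>For \<open>x > 1\<close> the factor \<open>lenS h + 1\<close> is at most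
    \<open>2 * x\<close>. The extra \<open>+ 1\<close> keeps the constant positive, as
    \<open>dominated\<close> demands, even for \<open>C = 0\<close>.\<close>
  have upper: "?f x \<le> ennreal 1 * ennreal (poly [:0, 1:] (1 * x)) + ennreal ((2 * real C + 1) * x)"
    if x: "x > 1" for x
  proof -
    obtain h where h: "h \<in> H" "real (lenS h) \<le> x" "?f x = ennreal (real (lenT h))"
      using distortion_attained[of x] x by auto
    have "real (lenT h) \<le> real (C * (lenS h + 1))" using assms[OF h(1)] of_nat_mono by blast
    also have "\<dots> = real C * (real (lenS h) + 1)" by (simp only: of_nat_mult of_nat_add of_nat_1)
    also have "\<dots> \<le> real C * (2 * x)" using h x by (intro mult_left_mono) auto
    also have "\<dots> \<le> (2 * real C + 1) * x" using x by (simp add: algebra_simps)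
    finally have "?f x \<le> ennreal ((2 * real C + 1) * x)" using h(3) by (simp add: ennreal_leI)
    then show ?thesis by (simp add: add_increasing)
  qed
  have "dominated ?f (\<lambda>x. ennreal (poly [:0, 1:] x))"
    by (rule dominatedI[OF _ _ _ _ upper]) auto
  moreover have "dominated (\<lambda>x. ennreal (poly [:0, 1:] x)) ?f"
    by (rule dominatedI[of 1 1 1 1]) (auto simp: add_increasing)
  moreover have "\<forall>\<^sub>F x::real in at_top. 0 \<le> poly [:0, 1:] x"
    by (rule eventually_mono[OF eventually_ge_at_top[of 0]]) simp
  ultimately show ?thesis
    unfolding linear_growth_def polynomial_growth_def growth_equiv_def
    by (intro exI[of _ "[:0, 1:]"]) simp
qed

lemma dominated_square_distortion:
  assumes "\<And>h. h \<in> H \<Longrightarrow> lenT h \<le> C * (lenS h + 1)\<^sup>2"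
  shows "dominated (distortion G S H T) (\<lambda>x. ennreal (poly [:0, 0, 1:] x))"
proof -
  let ?f = "distortion G S H T"
  have upper: "?f x \<le> ennreal (4 * real C + 1) * ennreal (poly [:0, 0, 1:] (1 * x)) + ennreal (1 * x)"
    if x: "x > 1" for x
  proof -
    obtain h where h: "h \<in> H" "real (lenS h) \<le> x" "?f x = ennreal (real (lenT h))"
      using distortion_attained[of x] x by auto
    have "real (lenT h) \<le> real (C * (lenS h + 1)\<^sup>2)" using assms[OF h(1)] of_nat_mono by blast
    also have "\<dots> = real C * (real (lenS h) + 1)\<^sup>2" by simp
    also have "\<dots> \<le> real C * (2 * x)\<^sup>2" using h x by (intro mult_left_mono power_mono) auto
    also have "\<dots> \<le> (4 * real C + 1) * (x * x)"
      using x by (simp add: algebra_simps power2_eq_square)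
    finally have "?f x \<le> ennreal ((4 * real C + 1) * (x * x))" using h(3) by (simp add: ennreal_leI)
    also have "\<dots> = ennreal (4 * real C + 1) * ennreal (x * x)" by (rule ennreal_mult) auto
    finally show ?thesis using x by (simp add: add_increasing2)
  qed
  show ?thesis
    by (rule dominatedI[OF _ _ _ _ upper]) auto
qed

lemma square_nonneg: "\<forall>\<^sub>F x::real in at_top. 0 \<le> poly [:0, 0, 1:] x"
  by (simp add: algebra_simps)

lemma at_most_quadratic_growth_distortion:
  assumes "\<And>h. h \<in> H \<Longrightarrow> lenT h \<le> C * (lenS h + 1)\<^sup>2"
  shows "at_most_quadratic_growth (distortion G S H T)"
proof -
  have "quadratic_growth (\<lambda>x. ennreal (poly [:0, 0, 1:] x))"
    unfolding quadratic_growth_def polynomial_growth_def growth_equiv_def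
    using dominated_refl square_nonneg by (intro exI[of _ "[:0, 0, 1:]"]) simp
  then show ?thesis
    unfolding at_most_quadratic_growth_def using dominated_square_distortion[OF assms] by blast
qed

text \<open>A lower bound along one sequence of elements suffices; the defect \<open>d * n\<close>
  is linear and vanishes in the slack of \<open>dominated\<close>.\<close>

lemma quadratic_growth_distortion:
  assumes upper: "\<And>h. h \<in> H \<Longrightarrow> lenT h \<le> C * (lenS h + 1)\<^sup>2"
    and lower: "\<And>n. \<exists>h\<in>H. lenS h \<le> c * n \<and> n\<^sup>2 \<le> a * lenT h + d * n"
  shows "quadratic_growth (distortion G S H T)"
proof -
  let ?f = "distortion G S H T"
  have low: "ennreal (poly [:0, 0, 1:] x)
      \<le> ennreal (4 * real a + 1) * ?f ((real c + 1) * x) + ennreal ((4 * real d + 1) * x)"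
    if x: "x > 1" for x
  proof -
    \<comment> \<open>Rounding down costs at most a factor 2 because \<open>x > 1\<close>; squaring
      turns it into the 4 of the constants.\<close>
    define n where "n = nat \<lfloor>x\<rfloor>"
    have "real n = of_int \<lfloor>x\<rfloor>" "1 \<le> \<lfloor>x\<rfloor>" using x by (auto simp: n_def)
    then have n: "real n \<le> x" "x \<le> 2 * real n" using \<open>real n = of_int \<lfloor>x\<rfloor>\<close> by linarith+
    obtain h where h: "h \<in> H" "lenS h \<le> c * n" "n\<^sup>2 \<le> a * lenT h + d * n" using lower by blast
    have "real (lenS h) \<le> real (c * n)" using h(2) by (rule of_nat_mono)
    also have "\<dots> \<le> (real c + 1) * x" using n x by (simp add: mult_mono)
    finally have ge: "ennreal (real (lenT h)) \<le> ?f ((real c + 1) * x)" using h(1) by (rule distortion_ge[rotated])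
    have "real (n\<^sup>2) \<le> real (a * lenT h + d * n)" using h(3) by (rule of_nat_mono)
    then have sq: "real n * real n \<le> real a * real (lenT h) + real d * real n"
      by (simp add: power2_eq_square)
    have "x * x \<le> (2 * real n) * (2 * real n)" using n x by (intro mult_mono) auto
    also have "\<dots> = 4 * (real n * real n)" by simp
    also have "\<dots> \<le> 4 * (real a * real (lenT h) + real d * real n)"
      by (rule mult_left_mono[OF sq]) simp
    also have "\<dots> = 4 * real a * real (lenT h) + 4 * real d * real n" by (simp add: algebra_simps)
    also have "\<dots> \<le> (4 * real a + 1) * real (lenT h) + (4 * real d + 1) * x"
      using n x by (intro add_mono mult_mono) auto
    finally have "ennreal (x * x) \<le> ennreal ((4 * real a + 1) * real (lenT h) + (4 * real d + 1) * x)"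
      by (rule ennreal_leI)
    also have "\<dots> = ennreal (4 * real a + 1) * ennreal (real (lenT h)) + ennreal ((4 * real d + 1) * x)"
      using x by (simp add: ennreal_plus ennreal_mult)
    also have "\<dots> \<le> ennreal (4 * real a + 1) * ?f ((real c + 1) * x) + ennreal ((4 * real d + 1) * x)"
      using ge by (intro add_mono mult_left_mono) auto
    finally show ?thesis by simp
  qed
  have "dominated (\<lambda>x. ennreal (poly [:0, 0, 1:] x)) ?f"
    by (rule dominatedI[OF _ _ _ _ low]) auto
  then show ?thesis
    unfolding quadratic_growth_def polynomial_growth_def growth_equiv_def
    using dominated_square_distortion[OF upper] square_nonneg
    by (intro exI[of _ "[:0, 0, 1:]"]) simp
qed

text \<open>Lengths are estimated over one convenient pair \<open>X\<close>, \<open>Y\<close>; a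
  change of generators on both sides affects only the constant. The exponent \<open>e\<close> lets
  one proof serve the linear and the quadratic case.\<close>

lemma transfer_bound:
  assumes X: "X \<subseteq> carrier G" "finite X" "generate G X = carrier G"
    and Y: "finite_gen_set G H Y"
    and bound: "\<And>h n. h \<in> H \<Longrightarrow> h \<in> word_ball X n \<Longrightarrow> h \<in> word_ball Y (C * (n + 1) ^ e)"
  shows "\<exists>C'. \<forall>h\<in>H. lenT h \<le> C' * (lenS h + 1) ^ e"
proof -
  have Y': "finite Y" "Y \<subseteq> generate G T" using Y generate_T by (auto simp: finite_gen_set_def)
  obtain k where k: "\<And>n. word_ball S n \<subseteq> word_ball X (k * n)"
    using word_ball_change_generators[OF X(1) finite_S] S_closed X(3) by blast
  obtain l where l: "\<And>n. word_ball Y n \<subseteq> word_ball T (l * n)"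
    using word_ball_change_generators[OF T_closed Y'] by blast
  have "lenT h \<le> (l * C * (k + 1) ^ e) * (lenS h + 1) ^ e" if h: "h \<in> H" for h
  proof -
    have "h \<in> word_ball S (lenS h)" using lenS_le_iff[of h "lenS h"] h H by auto
    then have "h \<in> word_ball X (k * lenS h)" using k by blast
    then have "h \<in> word_ball T (l * (C * (k * lenS h + 1) ^ e))" using bound[OF h] l by blast
    then have "lenT h \<le> l * (C * (k * lenS h + 1) ^ e)" using lenT_le_iff[OF h] by blast
    also have "\<dots> \<le> l * (C * ((k + 1) * (lenS h + 1)) ^ e)"
      by (intro mult_le_mono2 power_mono) auto
    also have "\<dots> = (l * C * (k + 1) ^ e) * (lenS h + 1) ^ e"
      by (simp only: power_mult_distrib mult.assoc)
    finally show ?thesis .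
  qed
  then show ?thesis by blast
qed

end

section \<open>Upper bounds for kernels of characters\<close>

context group
begin

lemma comm_generate:
  assumes "A \<subseteq> carrier G" "B \<subseteq> carrier G"
    and comm: "\<And>x y. x \<in> A \<Longrightarrow> y \<in> B \<Longrightarrow> x \<otimes> y = y \<otimes> x"
    and "g \<in> generate G A" "h \<in> generate G B"
  shows "g \<otimes> h = h \<otimes> g"
proof -
  have inv_comm: "inv x \<otimes> y = y \<otimes> inv x"
    if "x \<in> carrier G" "y \<in> carrier G" "x \<otimes> y = y \<otimes> x" for x y
    using that by (metis inv_closed inv_solve_left inv_solve_right m_assoc m_closed)
  have carr: "g \<in> carrier G" "h \<in> carrier G"
    using generate_in_carrier assms by auto
  have *: "x \<otimes> h = h \<otimes> x" if x: "x \<in> A" for x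
    using \<open>h \<in> generate G B\<close>
  proof (induction rule: generate.induct)
    case (inv y)
    then show ?case using inv_comm[of y x] comm[OF x] x assms(1,2) by (metis subsetD)
  next
    case (eng h1 h2)
    then have "h1 \<in> carrier G" "h2 \<in> carrier G" "x \<in> carrier G"
      using generate_in_carrier assms(1,2) x by auto
    then show ?case using eng by (metis m_assoc)
  qed (use x assms comm in auto)
  show ?thesis
    using \<open>g \<in> generate G A\<close>
  proof (induction rule: generate.induct)
    case (inv y)
    then show ?case using inv_comm[of y h] *[of y] assms(1) carr by auto
  next
    case (eng g1 g2)
    then have "g1 \<in> carrier G" "g2 \<in> carrier G"
      using generate_in_carrier assms(1) by auto
    then show ?case using eng carr by (metis m_assoc)
  qed (use * carr in auto)
qed

lemma int_pow_comm:
  assumes "x \<in> carrier G" "y \<in> carrier G" "x \<otimes> y = y \<otimes> x"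
  shows "x [^] (i::int) \<otimes> y [^] (j::int) = y [^] j \<otimes> x [^] i"
proof (rule comm_generate[of "{x}" "{y}"])
  show "x [^] i \<in> generate G {x}"
    using assms subgroup_int_pow_closed[OF generate_is_subgroup[of "{x}"]] by (simp add: generate.incl)
  show "y [^] j \<in> generate G {y}"
    using assms subgroup_int_pow_closed[OF generate_is_subgroup[of "{y}"]] by (simp add: generate.incl)
qed (use assms in auto)

text \<open>A letter from \<open>B\<close> moves past the part over \<open>A\<close> already
  collected. No letters are created, so each factor keeps the bound \<open>n\<close>.\<close>

lemma word_ball_Un_split:
  assumes "A \<subseteq> carrier G" "B \<subseteq> carrier G"
    and comm: "\<And>x y. x \<in> A \<Longrightarrow> y \<in> B \<Longrightarrow> x \<otimes> y = y \<otimes> x"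
    and "g \<in> word_ball (A \<union> B) n"
  obtains g1 g2 where "g1 \<in> word_ball A n" "g2 \<in> word_ball B n" "g = g1 \<otimes> g2"
proof -
  obtain ws where ws: "g = lprod ws" "length ws \<le> n" "set ws \<subseteq> A \<union> B \<union> m_inv G ` (A \<union> B)"
    using assms(4) by (rule word_ballE)
  have "\<exists>g1\<in>word_ball A (length ws). \<exists>g2\<in>word_ball B (length ws). lprod ws = g1 \<otimes> g2"
    using ws(3)
  proof (induction ws)
    case Nil
    show ?case by (intro bexI[of _ \<one>]) auto
  next
    case (Cons x ws)
    then obtain g1 g2 where g: "g1 \<in> word_ball A (length ws)" "g2 \<in> word_ball B (length ws)"
      "lprod ws = g1 \<otimes> g2" by auto
    have c: "g1 \<in> carrier G" "g2 \<in> carrier G"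
      using g word_ball_closed assms(1,2) by blast+
    have x: "x \<in> A \<union> m_inv G ` A \<or> x \<in> B \<union> m_inv G ` B"
      using Cons.prems by auto
    then have xc: "x \<in> carrier G" using assms(1,2) by auto
    from x show ?case
    proof
      assume "x \<in> A \<union> m_inv G ` A"
      then have "x \<otimes> g1 \<in> word_ball A (1 + length ws)"
        using mult_word_ball[OF assms(1) incl_word_ball[of A x 1]] assms(1) g by auto
      moreover have "lprod (x # ws) = (x \<otimes> g1) \<otimes> g2" using g c xc by (simp add: m_assoc)
      moreover have "g2 \<in> word_ball B (length (x # ws))"
        using g(2) word_ball_mono[of B B "length ws" "length (x # ws)"] by auto
      ultimately show ?thesis by auto
    next
      assume xB: "x \<in> B \<union> m_inv G ` B"
      then have "x \<otimes> g2 \<in> word_ball B (1 + length ws)"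
        using mult_word_ball[OF assms(2) incl_word_ball[of B x 1]] assms(2) g by auto
      moreover have "lprod (x # ws) = g1 \<otimes> (x \<otimes> g2)"
      proof -
        have "x \<in> generate G B" "g1 \<in> generate G A"
          using xB g generate_eq_word_balls[OF assms(1)] by (auto intro: generate.incl generate.inv)
        then have "g1 \<otimes> x = x \<otimes> g1" using comm_generate[OF assms(1,2) comm] by blast
        then show ?thesis using g c xc by (metis lprod_simps(2) m_assoc)
      qed
      moreover have "g1 \<in> word_ball A (length (x # ws))"
        using g(1) word_ball_mono[of A A "length ws" "length (x # ws)"] by auto
      ultimately show ?thesis by auto
    qed
  qed
  then show ?thesis
    using that ws word_ball_mono[of A A "length ws" n] word_ball_mono[of B B "length ws" n] by blast
qed

end

text \<open>Only commutation relations among generators enter the upper bounds, so these are proved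
  in any finitely generated group with an integer character.\<close>

locale int_hom = group G for G (structure) +
  fixes p :: "'a \<Rightarrow> int" and X :: "'a set"
  assumes hom: "p \<in> hom G integer_group"
    and X_closed: "X \<subseteq> carrier G"
    and finite_X: "finite X"
    and generate_X: "generate G X = carrier G"
begin

sublocale p: group_hom G integer_group p
  using hom by (intro group_hom.intro is_group group_integer_group group_hom_axioms.intro)

lemma p_mult [simp]: "x \<in> carrier G \<Longrightarrow> y \<in> carrier G \<Longrightarrow> p (x \<otimes> y) = p x + p y"
  using p.hom_mult by simp

lemma p_one [simp]: "p \<one> = 0"
  using p.hom_one by simp

lemma p_inv [simp]: "x \<in> carrier G \<Longrightarrow> p (inv x) = - p x"
  using p.hom_inv by simp

lemma p_int_pow [simp]: "x \<in> carrier G \<Longrightarrow> p (x [^] (k::int)) = k * p x"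
  using p.hom_int_pow by simp

abbreviation N :: "'a set" where "N \<equiv> kernel G integer_group p"

lemma N_iff: "x \<in> N \<longleftrightarrow> x \<in> carrier G \<and> p x = 0"
  by (simp add: kernel_def)

definition nball :: "nat \<Rightarrow> 'a set" where
  "nball L = N \<inter> word_ball X L"

text \<open>The first argument bounds the size of the letters in \<open>G\<close>, the second their
  number. For fixed \<open>L\<close>, the number \<open>k\<close> measures word length over the
  finite set \<open>nball L\<close>.\<close>

definition nprod :: "nat \<Rightarrow> nat \<Rightarrow> 'a set" where
  "nprod L k = word_ball (nball L) k"

lemma nball_closed: "nball L \<subseteq> carrier G"
  by (auto simp: nball_def N_iff)

lemma nprod_closed: "nprod L k \<subseteq> carrier G"
  unfolding nprod_def by (rule word_ball_closed[OF nball_closed])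

lemma nprod_carrier: "u \<in> nprod L k \<Longrightarrow> u \<in> carrier G"
  using nprod_closed by blast

lemma nprod_mono: "u \<in> nprod L k \<Longrightarrow> L \<le> L' \<Longrightarrow> k \<le> k' \<Longrightarrow> u \<in> nprod L' k'"
proof -
  assume a: "u \<in> nprod L k" "L \<le> L'" "k \<le> k'"
  have "nball L \<subseteq> nball L'"
    unfolding nball_def using word_ball_mono[of X X L L'] a by auto
  then show ?thesis using a word_ball_mono[of "nball L" "nball L'" k k'] by (auto simp: nprod_def)
qed

lemma nprod_one [simp]: "\<one> \<in> nprod L k"
  by (simp add: nprod_def)

lemma nprod_mult: "u \<in> nprod L k \<Longrightarrow> v \<in> nprod L l \<Longrightarrow> u \<otimes> v \<in> nprod L (k + l)"
  unfolding nprod_def by (rule mult_word_ball[OF nball_closed])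

lemma nprod_inv: "u \<in> nprod L k \<Longrightarrow> inv u \<in> nprod L k"
  unfolding nprod_def by (rule inv_word_ball[OF nball_closed])

lemma nball_nprod: "u \<in> nball L \<Longrightarrow> u \<in> nprod L 1"
  unfolding nprod_def using incl_word_ball[OF nball_closed, of u L 1] by auto

lemma nball_inv: "u \<in> nball L \<Longrightarrow> inv u \<in> nball L"
  using inv_word_ball[OF X_closed] by (auto simp: nball_def N_iff)

lemma p_nprod: "u \<in> nprod L k \<Longrightarrow> p u = 0"
proof -
  assume "u \<in> nprod L k"
  then obtain ws where ws: "u = lprod ws" "set ws \<subseteq> nball L \<union> m_inv G ` nball L"
    unfolding nprod_def by (rule word_ballE)
  then have "set ws \<subseteq> nball L" using nball_inv by auto
  then have "p (lprod ws) = 0 \<and> lprod ws \<in> carrier G"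
    using nball_closed by (induction ws) (auto simp: nball_def N_iff)
  then show ?thesis using ws by simp
qed

text \<open>Conjugation distributes over the letters: each grows by at most \<open>2 * l\<close> in
  \<open>G\<close>, but their number stays \<open>k\<close>.\<close>

lemma nprod_conj:
  assumes "u \<in> nprod L k" "g \<in> word_ball X l"
  shows "g \<otimes> u \<otimes> inv g \<in> nprod (L + 2 * l) k"
proof -
  obtain ws where ws: "u = lprod ws" "length ws \<le> k" "set ws \<subseteq> nball L \<union> m_inv G ` nball L"
    using assms(1) unfolding nprod_def by (rule word_ballE)
  then have ws': "set ws \<subseteq> nball L" using nball_inv by auto
  have g: "g \<in> carrier G" using assms(2) word_ball_closed[OF X_closed] by blast
  let ?f = "\<lambda>x. g \<otimes> x \<otimes> inv g"
  have f: "?f x \<in> nball (L + 2 * l)" if "x \<in> nball L" for x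
  proof -
    have x: "x \<in> carrier G" "p x = 0" "x \<in> word_ball X L" using that by (auto simp: nball_def N_iff)
    have "?f x \<in> word_ball X (l + L + l)"
      using assms(2) x inv_word_ball[OF X_closed] by (intro mult_word_ball X_closed) auto
    then show ?thesis using x g by (simp add: nball_def N_iff mult_2 ac_simps flip: mult_2_right)
  qed
  have "g \<otimes> lprod ws \<otimes> inv g = lprod (map ?f ws)"
    using ws'
  proof (induction ws)
    case (Cons x ws)
    then have c: "x \<in> carrier G" "lprod ws \<in> carrier G"
      using nball_closed by (auto intro!: lprod_closed)
    have "lprod (map ?f (x # ws)) = ?f x \<otimes> (g \<otimes> lprod ws \<otimes> inv g)" using Cons by simp
    also have "\<dots> = g \<otimes> x \<otimes> (inv g \<otimes> g) \<otimes> lprod ws \<otimes> inv g"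
      using c g by (simp only: m_assoc m_closed inv_closed)
    also have "\<dots> = g \<otimes> lprod (x # ws) \<otimes> inv g" using c g by (simp add: m_assoc)
    finally show ?case by simp
  qed (use g in simp)
  moreover have "lprod (map ?f ws) \<in> word_ball (nball (L + 2 * l)) k"
    using ws ws' f by (intro word_ballI) auto
  ultimately show ?thesis using ws by (simp add: nprod_def)
qed

section \<open>Conjugation by powers of a fixed element\<close>

lemma word_ball_exhausts: "g \<in> carrier G \<Longrightarrow> \<exists>l. g \<in> word_ball X l"
  using generate_X generate_eq_word_balls[OF X_closed] by auto

text \<open>The commutator of \<open>t [^] q\<close> and \<open>g\<close> always lies in the kernel;
  tameness asks that it costs a number of letters linear in \<open>q\<close>, with letters of
  bounded size. In the form \<open>u \<otimes> g\<close> this makes sense for \<open>g\<close>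
  outside the kernel, so it can be checked on generators.\<close>

definition tame :: "'a \<Rightarrow> 'a \<Rightarrow> bool" where
  "tame t g \<longleftrightarrow> (\<exists>C L. \<forall>q::int. \<exists>u\<in>nprod L (C * nat \<bar>q\<bar>).
     t [^] q \<otimes> g \<otimes> inv (t [^] q) = u \<otimes> g)"

text \<open>Commutators obey a cocycle rule: if \<open>u\<close> and \<open>v\<close> belong to
  \<open>g\<close> and \<open>h\<close>, then \<open>u\<close> times the conjugate of
  \<open>v\<close> by \<open>g\<close> belongs to \<open>g \<otimes> h\<close>. As \<open>g\<close>
  is fixed, this conjugation enlarges \<open>L\<close> by a constant.\<close>

lemma tame_mult:
  assumes t: "t \<in> carrier G" and g: "g \<in> carrier G" and h: "h \<in> carrier G"
    and "tame t g" "tame t h"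
  shows "tame t (g \<otimes> h)"
proof -
  obtain C1 L1 where 1: "\<And>q::int. \<exists>u\<in>nprod L1 (C1 * nat \<bar>q\<bar>). t [^] q \<otimes> g \<otimes> inv (t [^] q) = u \<otimes> g"
    using assms(4) unfolding tame_def by blast
  obtain C2 L2 where 2: "\<And>q::int. \<exists>u\<in>nprod L2 (C2 * nat \<bar>q\<bar>). t [^] q \<otimes> h \<otimes> inv (t [^] q) = u \<otimes> h"
    using assms(5) unfolding tame_def by blast
  obtain l where l: "g \<in> word_ball X l" using word_ball_exhausts[OF g] by blast
  have "\<exists>u\<in>nprod (L1 + L2 + 2 * l) ((C1 + C2) * nat \<bar>q\<bar>).
      t [^] q \<otimes> (g \<otimes> h) \<otimes> inv (t [^] q) = u \<otimes> (g \<otimes> h)" for q :: int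
  proof -
    obtain u where u: "u \<in> nprod L1 (C1 * nat \<bar>q\<bar>)" "t [^] q \<otimes> g \<otimes> inv (t [^] q) = u \<otimes> g"
      using 1 by blast
    obtain v where v: "v \<in> nprod L2 (C2 * nat \<bar>q\<bar>)" "t [^] q \<otimes> h \<otimes> inv (t [^] q) = v \<otimes> h"
      using 2 by blast
    have c: "u \<in> carrier G" "v \<in> carrier G" "t [^] q \<in> carrier G" using u v t nprod_carrier by auto
    have "t [^] q \<otimes> (g \<otimes> h) \<otimes> inv (t [^] q)
        = (t [^] q \<otimes> g \<otimes> inv (t [^] q)) \<otimes> (t [^] q \<otimes> h \<otimes> inv (t [^] q))"
      using c g h by (simp add: m_assoc inv_solve_left)
    also have "\<dots> = (u \<otimes> (g \<otimes> v \<otimes> inv g)) \<otimes> (g \<otimes> h)"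
      using c g h u v by (simp add: m_assoc inv_solve_left)
    finally have "t [^] q \<otimes> (g \<otimes> h) \<otimes> inv (t [^] q) = (u \<otimes> (g \<otimes> v \<otimes> inv g)) \<otimes> (g \<otimes> h)" .
    moreover have "u \<otimes> (g \<otimes> v \<otimes> inv g) \<in> nprod (L1 + L2 + 2 * l) (C1 * nat \<bar>q\<bar> + C2 * nat \<bar>q\<bar>)"
      using nprod_mono[OF u(1), of "L1 + L2 + 2 * l"]
        nprod_mono[OF nprod_conj[OF v(1) l], of "L1 + L2 + 2 * l"] by (intro nprod_mult) auto
    ultimately show ?thesis by (auto simp: add_mult_distrib)
  qed
  then show ?thesis unfolding tame_def by blast
qed

lemma tame_inv:
  assumes t: "t \<in> carrier G" and g: "g \<in> carrier G" and "tame t g"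
  shows "tame t (inv g)"
proof -
  obtain C L where 1: "\<And>q::int. \<exists>u\<in>nprod L (C * nat \<bar>q\<bar>). t [^] q \<otimes> g \<otimes> inv (t [^] q) = u \<otimes> g"
    using assms(3) unfolding tame_def by blast
  obtain l where l: "inv g \<in> word_ball X l" using word_ball_exhausts g by blast
  have "\<exists>u\<in>nprod (L + 2 * l) (C * nat \<bar>q\<bar>). t [^] q \<otimes> inv g \<otimes> inv (t [^] q) = u \<otimes> inv g" for q :: int
  proof -
    obtain u where u: "u \<in> nprod L (C * nat \<bar>q\<bar>)" "t [^] q \<otimes> g \<otimes> inv (t [^] q) = u \<otimes> g"
      using 1 by blast
    have c: "u \<in> carrier G" "t [^] q \<in> carrier G" using u t nprod_carrier by auto
    have "t [^] q \<otimes> inv g \<otimes> inv (t [^] q) = inv (t [^] q \<otimes> g \<otimes> inv (t [^] q))"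
      using c g by (simp add: inv_mult_group m_assoc)
    also have "\<dots> = (inv g \<otimes> inv u \<otimes> inv (inv g)) \<otimes> inv g"
      using c g u by (simp add: inv_mult_group m_assoc)
    finally show ?thesis using nprod_conj[OF nprod_inv[OF u(1)] l] by auto
  qed
  then show ?thesis unfolding tame_def by blast
qed

lemma tame_one: "t \<in> carrier G \<Longrightarrow> tame t \<one>"
  unfolding tame_def by (rule exI[of _ 0], rule exI[of _ 0]) (auto intro!: bexI[of _ \<one>])

lemma tame_all:
  assumes "t \<in> carrier G" "\<And>x. x \<in> X \<Longrightarrow> tame t x" "g \<in> carrier G"
  shows "tame t g"
proof -
  have "g \<in> generate G X" using assms generate_X by simp
  then show ?thesis
  proof (induction rule: generate.induct)
    case (eng g h)
    then show ?case using tame_mult assms(1) generate_X by simp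
  next
    case (inv g)
    then show ?case using tame_inv assms(1,2) X_closed by auto
  qed (use assms tame_one in auto)
qed

text \<open>For commuting \<open>v\<close>, \<open>w\<close> the power \<open>v\<^sup>q\<close> is \<open>w\<^sup>q\<close> up to a power of the kernel element
  \<open>v w\<inverse>\<close>; this is iterated along a path.\<close>

lemma power_along_path:
  fixes \<tau> :: "'c \<Rightarrow> 'a"
  assumes \<tau>: "\<And>v. v \<in> V \<Longrightarrow> \<tau> v \<in> carrier G \<and> p (\<tau> v) = m"
    and R: "R \<subseteq> {(v, w). v \<in> V \<and> w \<in> V \<and> \<tau> v \<otimes> \<tau> w = \<tau> w \<otimes> \<tau> v}"
    and "a \<in> V" "(a, v) \<in> R\<^sup>*"
  shows "\<exists>C L. \<forall>q::int. \<exists>u\<in>nprod L (C * nat \<bar>q\<bar>). \<tau> a [^] q = u \<otimes> \<tau> v [^] q"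
  using assms(4)
proof (induction rule: rtrancl_induct)
  case base
  then show ?case using \<tau>[OF \<open>a \<in> V\<close>] by (intro exI[of _ 0] allI bexI[of _ \<one>]) auto
next
  case (step v w)
  then have vw: "v \<in> V" "w \<in> V" "\<tau> v \<otimes> \<tau> w = \<tau> w \<otimes> \<tau> v" using R by auto
  note c = conjunct1[OF \<tau>[OF vw(1)]] conjunct1[OF \<tau>[OF vw(2)]]
  let ?z = "\<tau> v \<otimes> inv (\<tau> w)"
  obtain l where l: "?z \<in> word_ball X l" using word_ball_exhausts c by blast
  then have z: "?z \<in> nball l" using c \<tau> vw by (simp add: nball_def N_iff)
  obtain C L where CL: "\<And>q::int. \<exists>u\<in>nprod L (C * nat \<bar>q\<bar>). \<tau> a [^] q = u \<otimes> \<tau> v [^] q"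
    using step.IH by blast
  have "\<exists>u\<in>nprod (L + l) ((C + 1) * nat \<bar>q\<bar>). \<tau> a [^] q = u \<otimes> \<tau> w [^] q" for q :: int
  proof -
    obtain u where u: "u \<in> nprod L (C * nat \<bar>q\<bar>)" "\<tau> a [^] q = u \<otimes> \<tau> v [^] q" using CL by blast
    have zw: "?z \<otimes> \<tau> w = \<tau> v" using c by (simp add: m_assoc)
    have "\<tau> w \<otimes> ?z = \<tau> v \<otimes> (\<tau> w \<otimes> inv (\<tau> w))" using c vw(3) by (metis m_assoc inv_closed)
    then have "?z \<otimes> \<tau> w = \<tau> w \<otimes> ?z" using c zw by simp
    then have "\<tau> v [^] q = ?z [^] q \<otimes> \<tau> w [^] q"
      using int_pow_mult_distrib[of ?z "\<tau> w" q] c zw by simp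
    then have "\<tau> a [^] q = (u \<otimes> ?z [^] q) \<otimes> \<tau> w [^] q"
      using u c nprod_carrier by (simp add: m_assoc)
    moreover have "?z [^] q \<in> nprod l (1 * nat \<bar>q\<bar>)"
      using int_pow_word_ball[OF nball_closed] nball_nprod[OF z] unfolding nprod_def by blast
    then have "u \<otimes> ?z [^] q \<in> nprod (L + l) (C * nat \<bar>q\<bar> + 1 * nat \<bar>q\<bar>)"
      using u(1) by (intro nprod_mult) (auto intro: nprod_mono)
    ultimately show ?thesis unfolding add_mult_distrib by blast
  qed
  then show ?case by blast
qed

text \<open>Reidemeister--Schreier rewriting with respect to the transversal \<open>t\<^sup>q c\<close>, where \<open>c\<close> ranges
  over a finite set.\<close>

lemma schreier_rewriting:
  assumes "A \<subseteq> X" and t: "t \<in> carrier G" "p t = m" "m > 0"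
    and s: "s \<in> generate G A" "p s = m"
  obtains L0 D where "\<And>C L ws. L0 \<le> L \<Longrightarrow>
     (\<And>y q. y \<in> generate G (insert t A) \<Longrightarrow> y \<in> nball L0 \<Longrightarrow>
       \<exists>u\<in>nprod L (C * nat \<bar>q::int\<bar>). t [^] q \<otimes> y \<otimes> inv (t [^] q) = u \<otimes> y) \<Longrightarrow>
     set ws \<subseteq> A \<union> m_inv G ` A \<Longrightarrow>
     \<exists>n q c. lprod ws = n \<otimes> t [^] (q::int) \<otimes> c \<and>
       n \<in> nprod L (length ws * (C * D * length ws + 1)) \<and> nat \<bar>q\<bar> \<le> D * length ws \<and>
       c \<in> generate G A \<and> c \<in> word_ball X L0 \<and> 0 \<le> p c \<and> p c < m"
proof -
  have A: "A \<subseteq> carrier G" "insert t A \<subseteq> carrier G" using assms X_closed by auto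
  let ?H = "generate G A" and ?K = "generate G (insert t A)"
  have H: "subgroup ?H G" and K: "subgroup ?K G" using generate_is_subgroup A by auto
  have HK: "?H \<subseteq> ?K" by (rule mono_generate) auto
  have Hc: "?H \<subseteq> carrier G" using H subgroup.subset by blast
  have tK: "t \<in> ?K" by (auto intro: generate.incl)
  \<comment> \<open>One representative for each value of \<open>p\<close> on \<open>?H\<close>; only
    values in \<open>{0..<m}\<close> are used below, which keeps \<open>?F\<close> finite.\<close>
  have "\<exists>r. \<forall>e\<in>p ` ?H. r e \<in> ?H \<and> p (r e) = e"
    by (rule bchoice) auto
  then obtain r where r: "\<And>e. e \<in> p ` ?H \<Longrightarrow> r e \<in> ?H \<and> p (r e) = e" by blast
  let ?F = "r ` (p ` ?H \<inter> {0..<m}) \<union> {t}"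
  have F: "finite ?F" "?F \<subseteq> generate G X"
    using r Hc t generate_X by auto
  obtain l where l: "?F \<subseteq> word_ball X l"
    using finite_subset_word_ball[OF X_closed F] by blast
  define P where "P = (\<Sum>x\<in>X. \<bar>p x\<bar>)"
  have P: "\<bar>p x\<bar> \<le> P" if "x \<in> A \<union> m_inv G ` A" for x
  proof -
    obtain y where y: "y \<in> A" "x = y \<or> x = inv y" using \<open>x \<in> A \<union> m_inv G ` A\<close> by auto
    then have "\<bar>p x\<bar> = \<bar>p y\<bar>" using A by auto
    also have "\<dots> \<le> P" unfolding P_def using y assms(1) finite_X by (intro member_le_sum) auto
    finally show ?thesis .
  qed
  have "P \<ge> 0" unfolding P_def by (intro sum_nonneg) auto
  \<comment> \<open>A letter changes a remainder in \<open>{0..<m}\<close> by at most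
    \<open>P\<close>, so the new quotient by \<open>m\<close> is at most \<open>P + 1\<close> in
    absolute value: \<open>D\<close> bounds the growth of \<open>q\<close> per letter.\<close>
  define D where "D = nat P + 1"
  \<comment> \<open>The summands are the lengths of the factors \<open>c\<close>, \<open>x\<close>,
    \<open>inv (r e)\<close> and of the power of \<open>t\<close> in the element \<open>y'\<close>
    below.\<close>
  define L0 where "L0 = l + 1 + l + l * D"
  show ?thesis
  proof (rule that[of L0 D])
    fix C L :: nat and ws
    assume L: "L0 \<le> L" and ws: "set ws \<subseteq> A \<union> m_inv G ` A"
      and y: "\<And>y q. y \<in> ?K \<Longrightarrow> y \<in> nball L0 \<Longrightarrow>
       \<exists>u\<in>nprod L (C * nat \<bar>q::int\<bar>). t [^] q \<otimes> y \<otimes> inv (t [^] q) = u \<otimes> y"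
    \<comment> \<open>The induction needs the bound \<open>l\<close> on \<open>c\<close>, since
      \<open>L0\<close> is computed from it.\<close>
    have "\<exists>n q c. lprod ws = n \<otimes> t [^] (q::int) \<otimes> c \<and>
       n \<in> nprod L (length ws * (C * D * length ws + 1)) \<and> nat \<bar>q\<bar> \<le> D * length ws \<and>
       c \<in> ?H \<and> c \<in> word_ball X l \<and> 0 \<le> p c \<and> p c < m"
      using ws
    proof (induction ws rule: rev_induct)
      case Nil
      show ?case
        using t by (intro exI[of _ \<one>] exI[of _ 0]) (auto intro: generate.one)
    next
      case (snoc x ws)
      let ?n = "length ws"
      obtain n q c where IH: "lprod ws = n \<otimes> t [^] (q::int) \<otimes> c"
        "n \<in> nprod L (?n * (C * D * ?n + 1))" "nat \<bar>q\<bar> \<le> D * ?n"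
        "c \<in> ?H" "c \<in> word_ball X l" "0 \<le> p c" "p c < m"
        using snoc by auto
      have x: "x \<in> A \<union> m_inv G ` A" "x \<in> ?H" using snoc.prems by (auto intro: generate.incl generate.inv)
      have carr: "n \<in> carrier G" "c \<in> carrier G" "x \<in> carrier G" "s \<in> carrier G"
        using IH nprod_carrier Hc x s by auto
      define \<delta> where "\<delta> = p (c \<otimes> x) div m"
      define e where "e = p (c \<otimes> x) mod m"
      have e: "0 \<le> e" "e < m" "p (c \<otimes> x) = m * \<delta> + e" using t by (auto simp: \<delta>_def e_def)
      have "\<bar>\<delta>\<bar> \<le> P + 1"
      proof -
        have "m * \<delta> < m * (P + 2)"
        proof -
          have "m * \<delta> \<le> p c + p x" using e carr by simp
          also have "\<dots> < m + P" using IH P[OF x(1)] by linarith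
          also have "\<dots> \<le> m + m * P" using \<open>P \<ge> 0\<close> \<open>m > 0\<close> by (simp add: mult_le_cancel_right1)
          also have "\<dots> \<le> m * (P + 2)" using \<open>m > 0\<close> by (simp add: algebra_simps)
          finally show ?thesis .
        qed
        moreover have "m * (- P - 2) < m * \<delta>"
        proof -
          have "m * (- P - 2) = - (m * P) - 2 * m" by (simp add: algebra_simps)
          also have "\<dots> \<le> - P - 2 * m" using \<open>P \<ge> 0\<close> \<open>m > 0\<close> by (simp add: mult_le_cancel_right1)
          also have "\<dots> < p c + p x - m" using IH P[OF x(1)] \<open>m > 0\<close> by linarith
          also have "\<dots> < m * \<delta>" using e carr by simp
          finally show ?thesis .
        qed
        ultimately have "\<delta> < P + 2" "- P - 2 < \<delta>" using \<open>m > 0\<close> by simp_all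
        then show ?thesis by linarith
      qed
      then have \<delta>: "nat \<bar>\<delta>\<bar> \<le> D" using \<open>P \<ge> 0\<close> by (simp add: D_def)
      \<comment> \<open>\<open>t\<close> need not lie in \<open>?H\<close>. The element
        \<open>s\<close> has the same image and does lie in \<open>?H\<close>, so it shows that the
        remainder \<open>e\<close> is attained there.\<close>
      have "c \<otimes> x \<otimes> inv (s [^] \<delta>) \<in> ?H"
        using IH x s H by (simp add: subgroup.m_closed subgroup.m_inv_closed subgroup_int_pow_closed)
      moreover have "p (c \<otimes> x \<otimes> inv (s [^] \<delta>)) = e" using e carr s by (simp add: mult.commute)
      ultimately have "e \<in> p ` ?H" by (metis imageI)
      then have re: "r e \<in> ?H" "p (r e) = e" "r e \<in> word_ball X l" "t \<in> word_ball X l"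
        using r[of e] l e by auto
      have rc: "r e \<in> carrier G" using re Hc by auto
      \<comment> \<open>The Schreier generator: its image is 0 and its length is at most
        \<open>L0\<close>, so it ranges over a finite set.\<close>
      define y' where "y' = c \<otimes> x \<otimes> inv (r e) \<otimes> inv (t [^] \<delta>)"
      have y'c: "y' \<in> carrier G" using carr rc t by (simp add: y'_def)
      have y'eq: "c \<otimes> x = y' \<otimes> t [^] \<delta> \<otimes> r e"
        using carr rc t by (simp add: y'_def m_assoc)
      have "y' \<in> ?K" unfolding y'_def
        using IH(4) x(2) re(1) HK tK K
        by (intro subgroup.m_closed subgroup.m_inv_closed subgroup_int_pow_closed) auto
      moreover have x1: "x \<in> word_ball X 1"
        using x(1) assms(1) by (intro incl_word_ball X_closed) auto
      have "y' \<in> word_ball X (l + 1 + l + l * nat \<bar>\<delta>\<bar>)"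
        unfolding y'_def by (intro mult_word_ball X_closed inv_word_ball int_pow_word_ball IH(5) x1 re)
      then have "y' \<in> word_ball X L0"
        using word_ball_mono[of X X "l + 1 + l + l * nat \<bar>\<delta>\<bar>" L0] \<delta> by (auto simp: L0_def)
      then have y'n: "y' \<in> nball L0"
        using y'c carr rc t e re by (simp add: nball_def N_iff y'_def mult.commute)
      ultimately obtain u where u: "u \<in> nprod L (C * nat \<bar>q\<bar>)"
        "t [^] q \<otimes> y' \<otimes> inv (t [^] q) = u \<otimes> y'"
        using y[of y' q] by blast
      have uc: "u \<in> carrier G" using u nprod_carrier by auto
      have ty: "t [^] q \<otimes> y' = u \<otimes> y' \<otimes> t [^] q"
        using u(2) t y'c uc by (metis inv_solve_right' int_pow_closed m_closed)
      have wsc: "set ws \<subseteq> carrier G" using snoc.prems A by auto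
      have "lprod (ws @ [x]) = n \<otimes> t [^] q \<otimes> (c \<otimes> x)"
        using carr IH(1) t wsc by (simp add: m_assoc)
      also have "\<dots> = n \<otimes> (t [^] q \<otimes> y') \<otimes> t [^] \<delta> \<otimes> r e"
        unfolding y'eq using carr t y'c rc by (simp add: m_assoc)
      also have "\<dots> = (n \<otimes> (u \<otimes> y')) \<otimes> t [^] (q + \<delta>) \<otimes> r e"
        unfolding ty using carr t y'c rc uc by (simp add: m_assoc int_pow_mult)
      finally have "lprod (ws @ [x]) = (n \<otimes> (u \<otimes> y')) \<otimes> t [^] (q + \<delta>) \<otimes> r e" .
      moreover have "n \<otimes> (u \<otimes> y') \<in> nprod L (length (ws @ [x]) * (C * D * length (ws @ [x]) + 1))"
      proof -
        have "y' \<in> nprod L 1" using nprod_mono[OF nball_nprod[OF y'n]] L by simp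
        \<comment> \<open>Moving \<open>y'\<close> across \<open>t [^] q\<close> costs
          \<open>C * nat \<bar>q\<bar>\<close> letters, where \<open>q\<close> has grown at most
          linearly. The total is quadratic, and linear when \<open>C = 0\<close>.\<close>
        then have "n \<otimes> (u \<otimes> y') \<in> nprod L (?n * (C * D * ?n + 1) + (C * nat \<bar>q\<bar> + 1))"
          using IH(2) u(1) by (intro nprod_mult)
        moreover have "?n * (C * D * ?n + 1) + (C * nat \<bar>q\<bar> + 1)
            \<le> ?n * (C * D * ?n + 1) + (C * (D * ?n) + 1)"
          using IH(3) by (intro add_mono mult_left_mono) auto
        moreover have "?n * (C * D * ?n + 1) + (C * (D * ?n) + 1)
            \<le> length (ws @ [x]) * (C * D * length (ws @ [x]) + 1)"
          by (simp add: algebra_simps)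
        ultimately show ?thesis by (meson nprod_mono order_refl order_trans)
      qed
      moreover have "nat \<bar>q + \<delta>\<bar> \<le> D * length (ws @ [x])" using IH(3) \<delta> by auto
      ultimately show ?case using re e by metis
    qed
    moreover have "word_ball X l \<subseteq> word_ball X L0"
      by (rule word_ball_mono) (auto simp: L0_def)
    ultimately show "\<exists>n q c. lprod ws = n \<otimes> t [^] (q::int) \<otimes> c \<and>
       n \<in> nprod L (length ws * (C * D * length ws + 1)) \<and> nat \<bar>q\<bar> \<le> D * length ws \<and>
       c \<in> ?H \<and> c \<in> word_ball X L0 \<and> 0 \<le> p c \<and> p c < m"
      by blast
  qed
qed

text \<open>The constants of tameness depend on the element; over a finite set their sums serve
  everywhere. This is applied to \<open>nball L0\<close>, which is known before \<open>C\<close> and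
  \<open>L\<close> have to be chosen.\<close>

lemma tame_uniform:
  assumes "finite Y" "\<And>y. y \<in> Y \<Longrightarrow> tame t y"
  shows "\<exists>C L. \<forall>y\<in>Y. \<forall>q::int. \<exists>u\<in>nprod L (C * nat \<bar>q\<bar>). t [^] q \<otimes> y \<otimes> inv (t [^] q) = u \<otimes> y"
  using assms
proof (induction Y rule: finite_induct)
  case (insert y Y)
  obtain C1 L1 where 1: "\<And>z q. z \<in> Y \<Longrightarrow>
     \<exists>u\<in>nprod L1 (C1 * nat \<bar>q::int\<bar>). t [^] q \<otimes> z \<otimes> inv (t [^] q) = u \<otimes> z"
    using insert.IH insert.prems by blast
  obtain C2 L2 where 2: "\<And>q::int. \<exists>u\<in>nprod L2 (C2 * nat \<bar>q\<bar>). t [^] q \<otimes> y \<otimes> inv (t [^] q) = u \<otimes> y"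
    using insert.prems[of y] unfolding tame_def by blast
  have *: "u \<in> nprod (L1 + L2) ((C1 + C2) * k)" if "u \<in> nprod L1 (C1 * k) \<or> u \<in> nprod L2 (C2 * k)" for u k
    using that by (auto intro: nprod_mono)
  show ?case
  proof (intro exI ballI allI)
    fix z and q :: int
    assume "z \<in> insert y Y"
    then show "\<exists>u\<in>nprod (L1 + L2) ((C1 + C2) * nat \<bar>q\<bar>). t [^] q \<otimes> z \<otimes> inv (t [^] q) = u \<otimes> z"
      using 1[of z q] 2[of q] * by blast
  qed
qed auto

text \<open>\<open>m\<close> is the absolute value of the product of the images, and
  \<open>k v\<close> is \<open>m div p v\<close>. It may be negative, so generators of negative
  image reach the same positive \<open>m\<close>.\<close>

lemma common_power:
  assumes "finite V" "\<And>v. v \<in> V \<Longrightarrow> v \<in> carrier G \<and> p v \<noteq> 0"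
  obtains m k where "m > 0" "\<And>v. v \<in> V \<Longrightarrow> p (v [^] (k v :: int)) = m"
proof -
  define m where "m = \<bar>\<Prod>v\<in>V. p v\<bar>"
  have "m > 0" using assms by (simp add: m_def)
  moreover have "p (v [^] (m div p v)) = m" if "v \<in> V" for v
  proof -
    have "p v dvd m" using that assms(1) by (simp add: m_def dvd_prodI)
    then show ?thesis using assms(2)[OF that] by simp
  qed
  ultimately show ?thesis by (rule that[of m "\<lambda>v. m div p v"])
qed

section \<open>Quadratic and linear upper bounds\<close>

text \<open>\<open>R\<close> plays the part of the edges between generators of nonzero image.
  \<open>dom\<close> merges connectedness with the star condition: each generator commutes with a
  vertex reachable from \<open>a\<close>.\<close>

theorem kernel_quadratic:
  defines "X' \<equiv> {x \<in> X. p x \<noteq> 0}"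
  assumes a: "a \<in> X'"
    and R: "R \<subseteq> {(v, w). v \<in> X' \<and> w \<in> X' \<and> v \<otimes> w = w \<otimes> v}"
    and dom: "\<And>x. x \<in> X \<Longrightarrow> \<exists>v. (a, v) \<in> R\<^sup>* \<and> v \<otimes> x = x \<otimes> v"
  obtains C L where "\<And>g n. g \<in> N \<Longrightarrow> g \<in> word_ball X n \<Longrightarrow> g \<in> nprod L (C * (n + 1)\<^sup>2)"
proof -
  have X': "finite X'" "\<And>v. v \<in> X' \<Longrightarrow> v \<in> carrier G \<and> p v \<noteq> 0"
    using finite_X X_closed by (auto simp: X'_def)
  obtain m k where m: "m > 0" "\<And>v. v \<in> X' \<Longrightarrow> p (v [^] (k v :: int)) = m"
    using common_power[OF X'] by blast
  define \<tau> where "\<tau> v = v [^] k v" for v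
  have \<tau>: "\<tau> v \<in> carrier G \<and> p (\<tau> v) = m" if "v \<in> X'" for v
    using m(2)[OF that] X'(2)[OF that] by (simp add: \<tau>_def)
  have R\<tau>: "R \<subseteq> {(v, w). v \<in> X' \<and> w \<in> X' \<and> \<tau> v \<otimes> \<tau> w = \<tau> w \<otimes> \<tau> v}"
  proof (rule subrelI)
    fix v w assume "(v, w) \<in> R"
    then have "v \<in> X'" "w \<in> X'" "v \<otimes> w = w \<otimes> v" using R by blast+
    then show "(v, w) \<in> {(v, w). v \<in> X' \<and> w \<in> X' \<and> \<tau> v \<otimes> \<tau> w = \<tau> w \<otimes> \<tau> v}"
      using X'(2) int_pow_comm by (simp add: \<tau>_def)
  qed
  let ?t = "\<tau> a"
  have t: "?t \<in> carrier G" "p ?t = m" using \<tau>[OF a] by auto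
  have tame_X: "tame ?t x" if x: "x \<in> X" for x
  proof -
    have xc: "x \<in> carrier G" using x X_closed by auto
    obtain v where v: "(a, v) \<in> R\<^sup>*" "v \<otimes> x = x \<otimes> v" using dom[OF x] by blast
    have "v \<in> X'" using v(1) a R by (cases rule: rtranclE) auto
    note vc = X'(2)[OF this] \<tau>[OF this]
    obtain C L where CL: "\<And>q::int. \<exists>u\<in>nprod L (C * nat \<bar>q\<bar>). ?t [^] q = u \<otimes> \<tau> v [^] q"
      using power_along_path[where \<tau> = \<tau> and V = X' and m = m, OF \<tau> R\<tau> a v(1)] by blast
    obtain l where l: "x \<in> word_ball X l" using word_ball_exhausts[OF xc] by blast
    have "\<exists>u\<in>nprod (L + 2 * l) (2 * C * nat \<bar>q\<bar>). ?t [^] q \<otimes> x \<otimes> inv (?t [^] q) = u \<otimes> x" for q :: int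
    proof -
      obtain u where u: "u \<in> nprod L (C * nat \<bar>q\<bar>)" "?t [^] q = u \<otimes> \<tau> v [^] q"
        using CL by blast
      have uc: "u \<in> carrier G" using u nprod_carrier by auto
      let ?s = "\<tau> v [^] q"
      have sc: "?s \<in> carrier G" using vc by simp
      have "?s \<otimes> x = x \<otimes> ?s"
        using int_pow_comm[of v x "k v * q" 1] v vc xc by (simp add: \<tau>_def int_pow_pow)
      then have sx: "?s \<otimes> x \<otimes> inv ?s = x"
        using sc xc by (simp add: inv_solve_right')
      \<comment> \<open>As \<open>?s\<close> commutes with \<open>x\<close>, conjugating
        \<open>x\<close> by \<open>?t [^] q\<close> is conjugating it by \<open>u\<close>; the
        commutator of \<open>u\<close> and \<open>x\<close> is \<open>u\<close> times a conjugate of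
        its inverse, hence the factor 2.\<close>
      have "?t [^] q \<otimes> x \<otimes> inv (?t [^] q) = u \<otimes> (?s \<otimes> x \<otimes> inv ?s) \<otimes> inv u"
        unfolding u(2) using sc uc xc by (simp add: inv_mult_group m_assoc)
      also have "\<dots> = (u \<otimes> (x \<otimes> inv u \<otimes> inv x)) \<otimes> x"
        unfolding sx using uc xc by (simp add: m_assoc)
      finally have "?t [^] q \<otimes> x \<otimes> inv (?t [^] q) = (u \<otimes> (x \<otimes> inv u \<otimes> inv x)) \<otimes> x" .
      moreover have "u \<otimes> (x \<otimes> inv u \<otimes> inv x) \<in> nprod (L + 2 * l) (C * nat \<bar>q\<bar> + C * nat \<bar>q\<bar>)"
        using nprod_conj[OF nprod_inv[OF u(1)] l] nprod_mono[OF u(1)] by (intro nprod_mult) auto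
      ultimately show ?thesis unfolding mult_2 add_mult_distrib by blast
    qed
    then show ?thesis unfolding tame_def by blast
  qed
  have tame: "tame ?t g" if "g \<in> carrier G" for g using tame_all[OF t(1) tame_X that] .
  have "?t \<in> generate G X" using t generate_X by simp
  from schreier_rewriting[OF order_refl t m(1) this t(2)]
  obtain L0 D where LD: "\<And>C L ws. L0 \<le> L \<Longrightarrow>
     (\<And>y q. y \<in> generate G (insert ?t X) \<Longrightarrow> y \<in> nball L0 \<Longrightarrow>
       \<exists>u\<in>nprod L (C * nat \<bar>q::int\<bar>). ?t [^] q \<otimes> y \<otimes> inv (?t [^] q) = u \<otimes> y) \<Longrightarrow>
     set ws \<subseteq> X \<union> m_inv G ` X \<Longrightarrow>
     \<exists>n q c. lprod ws = n \<otimes> ?t [^] (q::int) \<otimes> c \<and>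
       n \<in> nprod L (length ws * (C * D * length ws + 1)) \<and> nat \<bar>q\<bar> \<le> D * length ws \<and>
       c \<in> generate G X \<and> c \<in> word_ball X L0 \<and> 0 \<le> p c \<and> p c < m"
    by blast
  have "finite (nball L0)" unfolding nball_def using finite_word_ball[OF finite_X] by simp
  moreover have "\<And>y. y \<in> nball L0 \<Longrightarrow> tame ?t y" using tame nball_closed by blast
  ultimately obtain C L where CL: "\<forall>y\<in>nball L0. \<forall>q::int.
    \<exists>u\<in>nprod L (C * nat \<bar>q\<bar>). ?t [^] q \<otimes> y \<otimes> inv (?t [^] q) = u \<otimes> y"
    using tame_uniform[of "nball L0" ?t] by blast
  have "g \<in> nprod (L + L0) ((C * D + 2) * (n + 1)\<^sup>2)" if g: "g \<in> N" "g \<in> word_ball X n" for g n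
  proof -
    obtain ws where ws: "g = lprod ws" "length ws \<le> n" "set ws \<subseteq> X \<union> m_inv G ` X"
      using g(2) by (rule word_ballE)
    have "\<exists>n q c. lprod ws = n \<otimes> ?t [^] (q::int) \<otimes> c \<and>
       n \<in> nprod (L + L0) (length ws * (C * D * length ws + 1)) \<and> nat \<bar>q\<bar> \<le> D * length ws \<and>
       c \<in> generate G X \<and> c \<in> word_ball X L0 \<and> 0 \<le> p c \<and> p c < m"
    proof (rule LD[OF _ _ ws(3)])
      fix y and q :: int
      assume "y \<in> nball L0"
      then show "\<exists>u\<in>nprod (L + L0) (C * nat \<bar>q\<bar>). ?t [^] q \<otimes> y \<otimes> inv (?t [^] q) = u \<otimes> y"
        using CL nprod_mono[of _ L _ "L + L0"] by (meson le_add1 order_refl)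
    qed simp
    then obtain h q c where h: "g = h \<otimes> ?t [^] (q::int) \<otimes> c"
      "h \<in> nprod (L + L0) (length ws * (C * D * length ws + 1))"
      "c \<in> word_ball X L0" "0 \<le> p c" "p c < m"
      using ws by blast
    have hc: "h \<in> carrier G" "c \<in> carrier G"
      using h nprod_carrier word_ball_closed[OF X_closed] by blast+
    have "p g = q * m + p c" using h(1) hc t p_nprod[OF h(2)] by simp
    then have qm: "q * m + p c = 0" using g by (simp add: N_iff)
    \<comment> \<open>\<open>p g = 0\<close> and \<open>0 \<le> p c < m\<close> leave no other
      multiple of \<open>m\<close>; so the last factor is a single letter from
      \<open>nball L0\<close>.\<close>
    have "q = 0"
    proof (rule ccontr)
      assume "q \<noteq> 0"
      then have "m \<le> \<bar>q\<bar> * m" using m(1) by (simp add: mult_le_cancel_right1)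
      then have "m \<le> \<bar>q * m\<bar>" using m(1) by (simp add: abs_mult)
      then show False using qm h by linarith
    qed
    then have gc: "g = h \<otimes> c" "c \<in> nball L0" using h hc qm by (auto simp: nball_def N_iff)
    have "c \<in> nprod (L + L0) 1" using nball_nprod[OF gc(2)] by (rule nprod_mono) auto
    then have "g \<in> nprod (L + L0) (length ws * (C * D * length ws + 1) + 1)"
      unfolding gc(1) by (rule nprod_mult[OF h(2)])
    moreover have "length ws * (C * D * length ws + 1) + 1 \<le> n * (C * D * n + 1) + 1"
      using ws(2) by (intro add_mono mult_mono) auto
    moreover have "n * (C * D * n + 1) + 1 \<le> (C * D + 2) * (n + 1)\<^sup>2"
      by (simp add: algebra_simps power2_eq_square)
    ultimately show ?thesis by (meson nprod_mono order_refl order_trans)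
  qed
  then show ?thesis using that by blast
qed

text \<open>\<open>t\<close> comes from \<open>B\<close> and centralises \<open>A\<close>; for
  \<open>s\<close> the roles are reversed. Conjugation in the rewriting is then trivial, its
  constant is 0, and the quadratic term drops out. The power of \<open>t\<close> left over by the
  \<open>A\<close>-part is handed to the \<open>B\<close>-part, whose own remainder
  \<open>s [^] q2\<close> is bounded because \<open>p g = 0\<close>.\<close>

theorem kernel_linear:
  assumes AB: "X = A \<union> B"
    and comm: "\<And>x y. x \<in> A \<Longrightarrow> y \<in> B \<Longrightarrow> x \<otimes> y = y \<otimes> x"
    and a: "a \<in> A" "p a \<noteq> 0" and b: "b \<in> B" "p b \<noteq> 0"
  obtains C L where "\<And>g n. g \<in> N \<Longrightarrow> g \<in> word_ball X n \<Longrightarrow> g \<in> nprod L (C * (n + 1))"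
proof -
  have Ac: "A \<subseteq> carrier G" and Bc: "B \<subseteq> carrier G" using AB X_closed by auto
  have comm': "\<And>x y. x \<in> B \<Longrightarrow> y \<in> A \<Longrightarrow> x \<otimes> y = y \<otimes> x" using comm by simp
  have "finite {a, b}" "\<And>v. v \<in> {a, b} \<Longrightarrow> v \<in> carrier G \<and> p v \<noteq> 0" using a b Ac Bc by auto
  from common_power[OF this] obtain m k
    where m: "m > 0" "\<And>v. v \<in> {a, b} \<Longrightarrow> p (v [^] (k v :: int)) = m" by blast
  define s where "s = a [^] k a"
  define t where "t = b [^] k b"
  have sA: "s \<in> generate G A" and tB: "t \<in> generate G B"
    using a b subgroup_int_pow_closed[OF generate_is_subgroup] Ac Bc
    unfolding s_def t_def by (auto intro: generate.incl)
  have s: "s \<in> carrier G" "p s = m" and t: "t \<in> carrier G" "p t = m"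
    using m(2)[of a] m(2)[of b] a b Ac Bc unfolding s_def t_def by auto
  obtain l where l: "t \<in> word_ball B l" using tB generate_eq_word_balls[OF Bc] by auto
  obtain ls where ls: "s \<in> word_ball X ls" using word_ball_exhausts s by blast
  have central: "t' [^] q \<otimes> y \<otimes> inv (t' [^] q) = \<one> \<otimes> y"
    if "E \<subseteq> carrier G" "t' \<in> carrier G" "\<And>x. x \<in> E \<Longrightarrow> t' \<otimes> x = x \<otimes> t'"
      "y \<in> generate G (insert t' E)" for t' E y and q :: int
  proof -
    have yc: "y \<in> carrier G" using that(4) generate_in_carrier[of "insert t' E"] that(1,2) by auto
    have "t' [^] q \<in> generate G {t'}"
      using that(2) subgroup_int_pow_closed[OF generate_is_subgroup[of "{t'}"]]
      by (simp add: generate.incl)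
    then have "t' [^] q \<otimes> y = y \<otimes> t' [^] q"
      using comm_generate[of "{t'}" "insert t' E"] that by auto
    then show ?thesis using yc that(2) by (simp add: inv_solve_right')
  qed
  have t_A: "t \<otimes> x = x \<otimes> t" if "x \<in> A" for x
    using comm_generate[OF Bc Ac comm' tB, of x] that by (auto intro: generate.incl)
  have s_B: "s \<otimes> x = x \<otimes> s" if "x \<in> B" for x
    using comm_generate[OF Ac Bc comm sA, of x] that by (auto intro: generate.incl)
  have AX: "A \<subseteq> X" and BX: "B \<subseteq> X" using AB by auto
  obtain L1 D1 where LD1: "\<And>C L ws. L1 \<le> L \<Longrightarrow>
     (\<And>y q. y \<in> generate G (insert t A) \<Longrightarrow> y \<in> nball L1 \<Longrightarrow>
       \<exists>u\<in>nprod L (C * nat \<bar>q::int\<bar>). t [^] q \<otimes> y \<otimes> inv (t [^] q) = u \<otimes> y) \<Longrightarrow>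
     set ws \<subseteq> A \<union> m_inv G ` A \<Longrightarrow>
     \<exists>n q c. lprod ws = n \<otimes> t [^] (q::int) \<otimes> c \<and>
       n \<in> nprod L (length ws * (C * D1 * length ws + 1)) \<and> nat \<bar>q\<bar> \<le> D1 * length ws \<and>
       c \<in> generate G A \<and> c \<in> word_ball X L1 \<and> 0 \<le> p c \<and> p c < m"
    using schreier_rewriting[OF AX t m(1) sA s(2)] by blast
  obtain L2 D2 where LD2: "\<And>C L ws. L2 \<le> L \<Longrightarrow>
     (\<And>y q. y \<in> generate G (insert s B) \<Longrightarrow> y \<in> nball L2 \<Longrightarrow>
       \<exists>u\<in>nprod L (C * nat \<bar>q::int\<bar>). s [^] q \<otimes> y \<otimes> inv (s [^] q) = u \<otimes> y) \<Longrightarrow>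
     set ws \<subseteq> B \<union> m_inv G ` B \<Longrightarrow>
     \<exists>n q c. lprod ws = n \<otimes> s [^] (q::int) \<otimes> c \<and>
       n \<in> nprod L (length ws * (C * D2 * length ws + 1)) \<and> nat \<bar>q\<bar> \<le> D2 * length ws \<and>
       c \<in> generate G B \<and> c \<in> word_ball X L2 \<and> 0 \<le> p c \<and> p c < m"
    using schreier_rewriting[OF BX s m(1) tB t(2)] by blast
  define L where "L = L1 + L2 + ls"
  \<comment> \<open>The \<open>A\<close>-part contributes at most \<open>n\<close> letters, the
    \<open>B\<close>-part \<open>l * D1 * n + n\<close>, and the remainder one.\<close>
  define C where "C = l * D1 + 3"
  have "g \<in> nprod L (C * (n + 1))" if g: "g \<in> N" "g \<in> word_ball X n" for g n
  proof -
    obtain g1 g2 where g12: "g1 \<in> word_ball A n" "g2 \<in> word_ball B n" "g = g1 \<otimes> g2"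
      using word_ball_Un_split[OF Ac Bc comm] g AB by blast
    obtain ws where ws: "g1 = lprod ws" "length ws \<le> n" "set ws \<subseteq> A \<union> m_inv G ` A"
      using g12(1) by (rule word_ballE)
    have "\<exists>n q c. lprod ws = n \<otimes> t [^] (q::int) \<otimes> c \<and>
       n \<in> nprod L1 (length ws * (0 * D1 * length ws + 1)) \<and> nat \<bar>q\<bar> \<le> D1 * length ws \<and>
       c \<in> generate G A \<and> c \<in> word_ball X L1 \<and> 0 \<le> p c \<and> p c < m"
      by (rule LD1[OF order_refl _ ws(3)]) (use central[OF Ac t(1) t_A] in \<open>auto intro!: bexI[of _ \<one>]\<close>)
    then obtain n1 q1 c1 where 1: "g1 = n1 \<otimes> t [^] (q1::int) \<otimes> c1" "n1 \<in> nprod L1 (length ws)"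
      "nat \<bar>q1\<bar> \<le> D1 * length ws" "c1 \<in> generate G A" "c1 \<in> word_ball X L1" "0 \<le> p c1" "p c1 < m"
      using ws by auto
    have "t [^] q1 \<otimes> g2 \<in> word_ball B (l * nat \<bar>q1\<bar> + n)"
      using l g12(2) by (intro mult_word_ball int_pow_word_ball Bc)
    then obtain vs where vs: "t [^] q1 \<otimes> g2 = lprod vs" "length vs \<le> l * nat \<bar>q1\<bar> + n"
      "set vs \<subseteq> B \<union> m_inv G ` B" by (rule word_ballE)
    have "\<exists>n q c. lprod vs = n \<otimes> s [^] (q::int) \<otimes> c \<and>
       n \<in> nprod L2 (length vs * (0 * D2 * length vs + 1)) \<and> nat \<bar>q\<bar> \<le> D2 * length vs \<and>
       c \<in> generate G B \<and> c \<in> word_ball X L2 \<and> 0 \<le> p c \<and> p c < m"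
      by (rule LD2[OF order_refl _ vs(3)]) (use central[OF Bc s(1) s_B] in \<open>auto intro!: bexI[of _ \<one>]\<close>)
    then obtain n2 q2 c2 where 2: "t [^] q1 \<otimes> g2 = n2 \<otimes> s [^] (q2::int) \<otimes> c2" "n2 \<in> nprod L2 (length vs)"
      "c2 \<in> word_ball X L2" "0 \<le> p c2" "p c2 < m"
      using vs by auto
    have carr: "n1 \<in> carrier G" "n2 \<in> carrier G" "c1 \<in> carrier G" "c2 \<in> carrier G" "g2 \<in> carrier G"
      using 1 2 g12 nprod_carrier word_ball_closed[OF X_closed] word_ball_closed[OF Bc] by blast+
    have "lprod vs \<in> generate G B"
      using vs(3) generate_eq_word_balls[OF Bc] word_ballI[of vs "length vs" B] by auto
    then have cc: "c1 \<otimes> (t [^] q1 \<otimes> g2) = (t [^] q1 \<otimes> g2) \<otimes> c1"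
      using comm_generate[OF Ac Bc comm 1(4)] vs(1) by simp
    have tq: "t [^] q1 \<otimes> c1 = c1 \<otimes> t [^] q1"
      using comm_generate[OF Bc Ac comm' _ 1(4)] tB subgroup_int_pow_closed[OF generate_is_subgroup[OF Bc]]
      by simp
    have "g = n1 \<otimes> (t [^] q1 \<otimes> c1) \<otimes> g2" using g12 1 carr t by (simp add: m_assoc)
    also have "\<dots> = n1 \<otimes> (c1 \<otimes> (t [^] q1 \<otimes> g2))" unfolding tq using carr t by (simp add: m_assoc)
    also have "\<dots> = n1 \<otimes> (n2 \<otimes> s [^] q2 \<otimes> c2 \<otimes> c1)" unfolding cc using 2(1) by simp
    also have "\<dots> = n1 \<otimes> (n2 \<otimes> (s [^] q2 \<otimes> c2 \<otimes> c1))" using carr s by (simp add: m_assoc)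
    finally have geq: "g = n1 \<otimes> (n2 \<otimes> (s [^] q2 \<otimes> c2 \<otimes> c1))" .
    have "p g = q2 * m + p c2 + p c1"
      unfolding geq using carr s p_nprod[OF 1(2)] p_nprod[OF 2(2)] by simp
    then have pg: "q2 * m + p c2 + p c1 = 0" using g by (simp add: N_iff)
    \<comment> \<open>\<open>p c1\<close> and \<open>p c2\<close> lie in \<open>{0..<m}\<close>, so
      their sum is below \<open>2 * m\<close>.\<close>
    have "nat \<bar>q2\<bar> \<le> 1"
    proof (rule ccontr)
      assume "\<not> nat \<bar>q2\<bar> \<le> 1"
      then have "2 * m \<le> \<bar>q2\<bar> * m" using m(1) by (intro mult_right_mono) auto
      then have "2 * m \<le> \<bar>q2 * m\<bar>" using m(1) by (simp add: abs_mult)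
      then show False using pg 1 2 by linarith
    qed
    have "s [^] q2 \<otimes> c2 \<otimes> c1 \<in> word_ball X (ls * nat \<bar>q2\<bar> + L2 + L1)"
      using 1 2 ls by (intro mult_word_ball int_pow_word_ball X_closed) auto
    moreover have "ls * nat \<bar>q2\<bar> \<le> ls * 1" using \<open>nat \<bar>q2\<bar> \<le> 1\<close> by (rule mult_le_mono2)
    then have "ls * nat \<bar>q2\<bar> + L2 + L1 \<le> L" by (simp add: L_def)
    ultimately have "s [^] q2 \<otimes> c2 \<otimes> c1 \<in> nball L"
      using word_ball_mono[of X X _ L] pg carr s by (auto simp: nball_def N_iff)
    then have "s [^] q2 \<otimes> c2 \<otimes> c1 \<in> nprod L 1" by (rule nball_nprod)
    moreover have "n1 \<in> nprod L (length ws)" "n2 \<in> nprod L (length vs)"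
      using 1(2) 2(2) by (auto intro: nprod_mono simp: L_def)
    ultimately have "g \<in> nprod L (length ws + (length vs + 1))"
      unfolding geq by (intro nprod_mult)
    moreover have "length ws + (length vs + 1) \<le> C * (n + 1)"
    proof -
      have "l * nat \<bar>q1\<bar> \<le> l * (D1 * n)" using 1(3) ws(2) by (meson le_trans mult_le_mono2)
      then have "length ws + (length vs + 1) \<le> n + (l * (D1 * n) + n + 1)"
        using ws(2) vs(2) by linarith
      also have "\<dots> \<le> C * (n + 1)" by (simp add: C_def algebra_simps)
      finally show ?thesis .
    qed
    ultimately show ?thesis by (meson nprod_mono order_refl)
  qed
  then show ?thesis using that by blast
qed

text \<open>Any bound, whatever \<open>f\<close>, makes the finite set \<open>nball L\<close>
  generate the kernel, since every kernel element lies in some ball.\<close>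

lemma finite_gen_set_nball:
  assumes "\<And>g n. g \<in> N \<Longrightarrow> g \<in> word_ball X n \<Longrightarrow> g \<in> nprod L (f n)"
  shows "finite_gen_set G N (nball L)"
proof -
  have "generate G (nball L) = N"
  proof
    show "generate G (nball L) \<subseteq> N"
      using generate_eq_word_balls[OF nball_closed] p_nprod nprod_carrier
      by (auto simp: nprod_def N_iff)
    show "N \<subseteq> generate G (nball L)"
    proof
      fix g assume g: "g \<in> N"
      then obtain n where "g \<in> word_ball X n" using word_ball_exhausts by (auto simp: N_iff)
      then show "g \<in> generate G (nball L)"
        using assms[OF g] generate_eq_word_balls[OF nball_closed] by (auto simp: nprod_def)
    qed
  qed
  then show ?thesis
    using finite_word_ball[OF finite_X] by (auto simp: finite_gen_set_def nball_def)
qed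

end

section \<open>Pilings and walls\<close>

text \<open>Pilings in the sense of Crisp, Godelle and Wiest: every vertex carries a stack, with its top at
  the head of the list. The letter \<open>(u, b)\<close> puts the bead \<open>Some b\<close> on the stack of \<open>u\<close> and the
  marker \<open>None\<close> on the stacks of the vertices that do not commute with \<open>u\<close>, unless it cancels
  against the top bead of \<open>u\<close>.\<close>

type_synonym 'v piling = "'v \<Rightarrow> bool option list"

text \<open>An empty stack and a marker on top both give \<open>None\<close>: in either case no
  letter can cancel.\<close>

definition top_bead :: "'v piling \<Rightarrow> 'v \<Rightarrow> bool option" where
  "top_bead s u = (if s u = [] then None else hd (s u))"

definition bead_le :: "'v piling \<Rightarrow> 'v piling \<Rightarrow> bool" where
  "bead_le r s \<longleftrightarrow> (\<forall>z. suffix (r z) (s z))"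

definition letter_sign :: "bool \<Rightarrow> int" where
  "letter_sign b = (if b then 1 else - 1)"

definition exponent :: "'v \<Rightarrow> 'v gword \<Rightarrow> int" where
  "exponent u w = (\<Sum>(x, b)\<leftarrow>w. if x = u then letter_sign b else 0)"

text \<open>Reads the exponent of a vertex off its stack (\<open>bead_sum_pile\<close>), which makes
  this exponent available from the piling alone.\<close>

definition bead_sum :: "bool option list \<Rightarrow> int" where
  "bead_sum xs = (\<Sum>x\<leftarrow>xs. case x of None \<Rightarrow> 0 | Some b \<Rightarrow> letter_sign b)"

lemma bead_sum_simps [simp]:
  "bead_sum [] = 0" "bead_sum (None # xs) = bead_sum xs" "bead_sum (Some b # xs) = letter_sign b + bead_sum xs"
  by (auto simp: bead_sum_def)

lemma exponent_simps [simp]: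
  "exponent u [] = 0"
  "exponent u ((x, b) # w) = (if x = u then letter_sign b else 0) + exponent u w"
  "exponent u (w @ w') = exponent u w + exponent u w'"
  by (auto simp: exponent_def)

lemma bead_le_refl: "bead_le s s"
  by (simp add: bead_le_def)

lemma bead_le_trans: "bead_le r s \<Longrightarrow> bead_le s t \<Longrightarrow> bead_le r t"
  by (meson bead_le_def suffix_order.trans)

locale pilings =
  fixes V :: "'v set" and E :: "('v \<times> 'v) set"
  assumes finite_V: "finite V"
    and E_sym: "(u, v) \<in> E \<Longrightarrow> (v, u) \<in> E"
    and E_irrefl: "(u, u) \<notin> E"
begin

definition push :: "'v \<Rightarrow> bool \<Rightarrow> 'v piling \<Rightarrow> 'v piling" where
  "push u b s = (\<lambda>z. if z = u then Some b # s z else if (u, z) \<notin> E then None # s z else s z)"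

text \<open>\<open>E\<close> is irreflexive, so the condition includes \<open>z = u\<close>. Popping
  undoes a push only if the entries removed from the other stacks are the markers of that bead,
  which \<open>valid\<close> guarantees.\<close>

definition pop :: "'v \<Rightarrow> 'v piling \<Rightarrow> 'v piling" where
  "pop u s = (\<lambda>z. if (u, z) \<notin> E then tl (s z) else s z)"

definition act :: "'v piling \<Rightarrow> 'v \<times> bool \<Rightarrow> 'v piling" where
  "act s = (\<lambda>(u, b). if top_bead s u = Some (\<not> b) then pop u s else push u b s)"

inductive valid :: "'v piling \<Rightarrow> bool" where
  empty: "valid (\<lambda>_. [])"
| push: "valid s \<Longrightarrow> u \<in> V \<Longrightarrow> top_bead s u \<noteq> Some (\<not> b) \<Longrightarrow> valid (push u b s)"

lemma pop_push [simp]: "pop u (push u b s) = s"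
  by (auto simp: pop_def push_def E_irrefl fun_eq_iff)

lemma push_commute: "(u, w) \<in> E \<Longrightarrow> push u b (push w c s) = push w c (push u b s)"
  using E_sym[of u w] E_irrefl by (auto simp: push_def fun_eq_iff)

lemma top_push [simp]: "top_bead (push u b s) u = Some b"
  by (simp add: top_bead_def push_def)

lemma top_push_adj: "(u, w) \<in> E \<Longrightarrow> top_bead (push u b s) w = top_bead s w"
  using E_irrefl by (auto simp: top_bead_def push_def)

lemma top_push_nonadj: "w \<noteq> u \<Longrightarrow> (u, w) \<notin> E \<Longrightarrow> top_bead (push u b s) w = None"
  by (auto simp: top_bead_def push_def)

text \<open>A bead on top can be taken as the last one pushed. The actual last push, at
  \<open>w\<close>, is either this bead or adjacent to \<open>u\<close>, since otherwise it would
  have left a marker on top of \<open>u\<close>; adjacent pushes commute, so the induction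
  hypothesis applies beneath it.\<close>

lemma valid_unpush:
  "valid s \<Longrightarrow> top_bead s u = Some b \<Longrightarrow>
    \<exists>s'. valid s' \<and> s = push u b s' \<and> top_bead s' u \<noteq> Some (\<not> b)"
proof (induction arbitrary: u b rule: valid.induct)
  case empty
  then show ?case by (simp add: top_bead_def)
next
  case (push s w c)
  show ?case
  proof (cases "w = u")
    case True
    then have "c = b" using push.prems by simp
    then show ?thesis using push.hyps True by blast
  next
    case False
    then have wu: "(w, u) \<in> E" using push.prems top_push_nonadj[of u w] by force
    then have uw: "(u, w) \<in> E" by (rule E_sym)
    have "top_bead s u = Some b" using push.prems top_push_adj[OF wu] by simp
    then obtain s' where s': "valid s'" "s = push u b s'" "top_bead s' u \<noteq> Some (\<not> b)"
      using push.IH by blast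
    have "top_bead s' w \<noteq> Some (\<not> c)"
      using push.hyps s' top_push_adj[OF uw] by simp
    then have "valid (push w c s')" using s' push.hyps valid.push by blast
    moreover have "push w c s = push u b (push w c s')"
      using s' push_commute[OF wu] by simp
    moreover have "top_bead (push w c s') u \<noteq> Some (\<not> b)"
      using s' top_push_adj[OF wu] by simp
    ultimately show ?thesis by blast
  qed
qed

lemma act_push: "top_bead s u \<noteq> Some (\<not> b) \<Longrightarrow> act s (u, b) = push u b s"
  by (simp add: act_def)

lemma act_pop: "act (push u (\<not> b) s) (u, b) = s"
  by (simp add: act_def)

lemma act_cases:
  assumes "valid s"
  obtains "top_bead s u \<noteq> Some (\<not> b)" "act s (u, b) = push u b s"
  | s' where "valid s'" "s = push u (\<not> b) s'" "top_bead s' u \<noteq> Some b" "act s (u, b) = s'"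
proof (cases "top_bead s u = Some (\<not> b)")
  case True
  then obtain s' where "valid s'" "s = push u (\<not> b) s'" "top_bead s' u \<noteq> Some b"
    using valid_unpush[OF assms True] by auto
  then show ?thesis using that(2)[of s'] act_pop[of u b s'] by simp
next
  case False
  then show ?thesis using that(1) act_push by simp
qed

lemma valid_act:
  assumes "valid s" "u \<in> V"
  shows "valid (act s (u, b))"
  using assms(1) by (cases rule: act_cases[of s u b]) (use assms in \<open>auto intro: valid.push\<close>)

lemma act_cancel:
  assumes "valid s"
  shows "act (act s (u, b)) (u, \<not> b) = s"
  using assms
proof (cases rule: act_cases[of s u b])
  case 1
  then show ?thesis using act_pop[of u "\<not> b" s] by simp
next
  case (2 s')
  then show ?thesis using act_push[of s' u "\<not> b"] by simp
qed

lemma act_commute: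
  assumes s: "valid s" and uw: "(u, w) \<in> E"
  shows "act (act s (u, b)) (w, c) = act (act s (w, c)) (u, b)"
proof -
  have wu: "(w, u) \<in> E" using uw by (rule E_sym)
  note tops = top_push_adj[OF uw] top_push_adj[OF wu]
  note comm = push_commute[OF uw] push_commute[OF wu]
  from s show ?thesis
  proof (cases rule: act_cases[of s u b])
    case 1
    note u = this
    from s show ?thesis
    proof (cases rule: act_cases[of s w c])
      case 1
      then show ?thesis using u comm(2)[of c b s] by (simp add: act_push tops)
    next
      case (2 s')
      have "act (push w (\<not> c) (push u b s')) (w, c) = push u b s'" by (rule act_pop)
      moreover have "top_bead s' u \<noteq> Some (\<not> b)" using u 2 by (simp add: tops)
      ultimately show ?thesis using u 2 comm(1)[of b "\<not> c" s'] by (simp add: act_push)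
    qed
  next
    case (2 s')
    note u = this
    from s show ?thesis
    proof (cases rule: act_cases[of s w c])
      case 1
      have "act (push u (\<not> b) (push w c s')) (u, b) = push w c s'" by (rule act_pop)
      moreover have "top_bead s' w \<noteq> Some (\<not> c)" using u 1 by (simp add: tops)
      ultimately show ?thesis using u 1 comm(2)[of c "\<not> b" s'] by (simp add: act_push)
    next
      case (2 t)
      \<comment> \<open>Both letters cancel, so \<open>s\<close> ends in two commuting beads;
        removing them in either order leaves \<open>r\<close>.\<close>
      have "top_bead s w = Some (\<not> c)" unfolding 2(2) by (rule top_push)
      then have "top_bead s' w = Some (\<not> c)" using u(2) tops(1)[of "\<not> b" s'] by simp
      then obtain r where r: "s' = push w (\<not> c) r" using valid_unpush[OF u(1)] by blast
      have "t = pop w s" using 2 by simp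
      also have "\<dots> = push u (\<not> b) r" using u r comm(1)[of "\<not> b" "\<not> c" r] by simp
      finally have "act t (u, b) = r" using act_pop by simp
      moreover have "act s' (w, c) = r" using r act_pop by simp
      ultimately show ?thesis using u 2 by simp
    qed
  qed
qed

definition pile :: "'v gword \<Rightarrow> 'v piling" where
  "pile w = foldl act (\<lambda>_. []) w"

lemma valid_foldl: "valid s \<Longrightarrow> w \<in> gwords V \<Longrightarrow> valid (foldl act s w)"
  by (induction w arbitrary: s) (auto simp: gwords_def intro: valid_act)

lemma valid_pile: "w \<in> gwords V \<Longrightarrow> valid (pile w)"
  unfolding pile_def by (rule valid_foldl[OF valid.empty])

lemma pile_snoc: "pile (w @ [l]) = act (pile w) l"
  by (simp add: pile_def)

text \<open>Free cancellation and the commutation relations hold for the action on valid pilings, so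
  the group acts on them. Hence \<open>pile\<close> is an invariant of the group element, not just
  of the word.\<close>

lemma foldl_act_cong:
  assumes "(w, w') \<in> pres_cong V {([(s, True), (t, True)], [(t, True), (s, True)]) | s t. (s, t) \<in> E}"
    and "valid s"
  shows "foldl act s w = foldl act s w'"
  using assms
proof (induction arbitrary: s rule: pres_cong.induct)
  case (cancel u v x b)
  then show ?case using act_cancel[OF valid_foldl[OF cancel.prems]] by simp
next
  case (rel u v r r')
  then obtain x y where "(x, y) \<in> E" "r = [(x, True), (y, True)]" "r' = [(y, True), (x, True)]" by blast
  then show ?case
    using act_commute[OF valid_foldl[OF rel.prems \<open>u \<in> gwords V\<close>], of x y True True] by simp
qed auto

lemma pile_cong:
  "(w, w') \<in> pres_cong V {([(s, True), (t, True)], [(t, True), (s, True)]) | s t. (s, t) \<in> E} \<Longrightarrow>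
    pile w = pile w'"
  unfolding pile_def by (rule foldl_act_cong[OF _ valid.empty])

lemma bead_sum_act:
  assumes "valid s"
  shows "bead_sum (act s (u, b) v) = bead_sum (s v) + (if u = v then letter_sign b else 0)"
  using assms by (cases rule: act_cases[of s u b]) (auto simp: push_def letter_sign_def)

lemma bead_sum_pile: "w \<in> gwords V \<Longrightarrow> bead_sum (pile w v) = exponent v w"
proof (induction w rule: rev_induct)
  case Nil
  then show ?case by (simp add: pile_def)
next
  case (snoc l w)
  obtain u b where l: "l = (u, b)" by (cases l)
  have "w \<in> gwords V" using snoc.prems by (simp add: gwords_def)
  then show ?case using snoc.IH bead_sum_act[OF valid_pile] by (simp add: pile_snoc l)
qed

section \<open>Crossing into half-spaces of pilings\<close>

definition beads :: "bool option list \<Rightarrow> nat" where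
  "beads xs = length (filter (\<lambda>x. x \<noteq> None) xs)"

lemma beads_simps [simp]:
  "beads [] = 0" "beads (None # xs) = beads xs" "beads (Some b # xs) = Suc (beads xs)"
  "beads (xs @ ys) = beads xs + beads ys"
  by (auto simp: beads_def)

lemma beads_suffix: "suffix xs ys \<Longrightarrow> beads xs \<le> beads ys"
  by (auto simp: suffix_def)

text \<open>Every marker \<open>None\<close> in the stack of \<open>z\<close> comes from one bead in the stack of a vertex
  that does not commute with \<open>z\<close>.\<close>

lemma count_markers:
  "valid s \<Longrightarrow> length (filter (\<lambda>x. x = None) (s z)) = (\<Sum>u\<in>{u\<in>V. u \<noteq> z \<and> (u, z) \<notin> E}. beads (s u))"
proof (induction rule: valid.induct)
  case (push s u b)
  let ?A = "{u\<in>V. u \<noteq> z \<and> (u, z) \<notin> E}"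
  have "beads (push u b s w) = beads (s w) + (if w = u then 1 else 0)" for w
    by (auto simp: push_def)
  then have "(\<Sum>w\<in>?A. beads (push u b s w)) = (\<Sum>w\<in>?A. beads (s w)) + (if u \<in> ?A then 1 else 0)"
    using finite_V by (simp add: sum.distrib sum.delta)
  also have "\<dots> = length (filter (\<lambda>x. x = None) (push u b s z))"
    using push by (auto simp: push_def)
  finally show ?case by simp
qed simp

lemma bead_le_push: "bead_le s (push u b s)"
  by (auto simp: bead_le_def push_def suffix_Cons)

text \<open>Once the first letter does not cancel, its repetitions cannot cancel either. The tail of
  the words in the lower bound is of this kind.\<close>

lemma bead_le_replicate:
  "top_bead s u \<noteq> Some (\<not> c) \<Longrightarrow> bead_le s (foldl act s (replicate m (u, c)))"
proof (induction m arbitrary: s)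
  case (Suc m)
  then have "bead_le (push u c s) (foldl act (push u c s) (replicate m (u, c)))" by simp
  then show ?case using Suc.prems bead_le_trans[OF bead_le_push] by (simp add: act_push)
qed (simp add: bead_le_refl)

text \<open>The pilings above \<open>r\<close> form a half-space; crossing into it determines the stack of \<open>v\<close>.\<close>

lemma crossing:
  assumes r: "valid r" and s: "valid s" and u: "u \<in> V"
    and top: "\<And>z. top_bead r z \<noteq> None \<Longrightarrow> z = v"
    and cross: "\<not> bead_le r s" "bead_le r (act s (u, b))"
  shows "act s (u, b) v = r v"
proof -
  let ?s = "act s (u, b)"
  have valid: "valid ?s" using s u by (rule valid_act)
  have le: "suffix (r z) (?s z)" for z using cross(2) by (simp add: bead_le_def)
  \<comment> \<open>A cancelling letter leads to a smaller piling, so it cannot enter the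
    half-space.\<close>
  have push: "?s = push u b s"
    using s
  proof (cases rule: act_cases[of s u b])
    case (2 s')
    then have "bead_le ?s s" using bead_le_push[of s'] by simp
    then show ?thesis using cross bead_le_trans by blast
  qed
  obtain z where z: "\<not> suffix (r z) (s z)" using cross(1) by (auto simp: bead_le_def)
  then have "?s z \<noteq> s z" using le[of z] by auto
  then have z': "z = u \<or> (u, z) \<notin> E" by (auto simp: push push_def split: if_splits)
  \<comment> \<open>The stack of \<open>z\<close> was too short by exactly the entry just
    added.\<close>
  have rz: "?s z = r z" using z z' le[of z] by (auto simp: push push_def suffix_Cons)
  have "?s u = r u"
  proof (cases "z = u")
    case False
    let ?A = "{u\<in>V. u \<noteq> z \<and> (u, z) \<notin> E}"
    have uA: "u \<in> ?A" using u False z' by auto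
    show ?thesis
    proof (rule ccontr)
      assume "?s u \<noteq> r u"
      then have "suffix (r u) (s u)" using le[of u] by (auto simp: push push_def suffix_Cons)
      then have "beads (r u) < beads (?s u)"
        using beads_suffix by (fastforce simp: push push_def)
      \<comment> \<open>The bead just put on \<open>u\<close> would be a surplus over
        \<open>r\<close>. By \<open>count_markers\<close> the stack of \<open>z\<close> would then
        hold more markers in \<open>?s\<close> than in \<open>r\<close>, although the two stacks
        agree.\<close>
      then have "(\<Sum>w\<in>?A. beads (r w)) < (\<Sum>w\<in>?A. beads (?s w))"
        using uA beads_suffix[OF le] finite_V by (intro sum_strict_mono_ex1) auto
      then show False using count_markers[OF r, of z] count_markers[OF valid, of z] rz by simp
    qed
  qed (use rz in simp)
  \<comment> \<open>The bead just placed is the top of \<open>r u\<close>, and \<open>r\<close> has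
    a top bead only at \<open>v\<close>.\<close>
  then have "top_bead r u = top_bead ?s u" by (simp add: top_bead_def)
  then have "top_bead r u = Some b" by (simp add: push)
  then have "u = v" using top by force
  then show ?thesis using \<open>?s u = r u\<close> by simp
qed

end

section \<open>Periodic walks in the complement graph\<close>

locale complement_walk = pilings V E for V :: "'v set" and E +
  fixes v :: "nat \<Rightarrow> 'v" and k :: nat and b :: "'v \<Rightarrow> bool"
  assumes v_in: "v i \<in> V"
    and v_step: "v (Suc i) \<noteq> v i" "(v i, v (Suc i)) \<notin> E"
    and period: "v (i + k) = v i"
    and covers: "u \<in> V \<Longrightarrow> \<exists>i<k. v i = u"
begin

definition walk_word :: "nat \<Rightarrow> 'v gword" where
  "walk_word n = map (\<lambda>i. (v i, b (v i))) [0..<n]"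

lemma walk_word_Suc: "walk_word (Suc n) = walk_word n @ [(v n, b (v n))]"
  by (simp add: walk_word_def)

lemma walk_word_gwords: "walk_word n \<in> gwords V"
  using v_in by (auto simp: walk_word_def gwords_def)

text \<open>Each letter puts a marker on the stack of its predecessor, so a bead is exposed only at
  the last vertex. This is what \<open>crossing\<close> asks of \<open>r\<close>, and it prevents
  the next letter from cancelling. The conclusion \<open>n > 0\<close> guards the truncated
  \<open>n - 1\<close>.\<close>

lemma top_pile_walk:
  "top_bead (pile (walk_word n)) z \<noteq> None \<Longrightarrow> n > 0 \<and> z = v (n - 1)"
proof (induction n arbitrary: z)
  case 0
  then show ?case by (simp add: pile_def walk_word_def top_bead_def)
next
  case (Suc n)
  let ?r = "pile (walk_word n)"
  have top: "top_bead ?r (v n) = None"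
  proof (rule ccontr)
    assume "top_bead ?r (v n) \<noteq> None"
    then show False using Suc.IH[of "v n"] v_step(1)[of "n - 1"] by auto
  qed
  have pile: "pile (walk_word (Suc n)) = push (v n) (b (v n)) ?r"
    unfolding walk_word_Suc pile_snoc using top by (simp add: act_push)
  show ?case
  proof (rule ccontr)
    assume "\<not> (0 < Suc n \<and> z = v (Suc n - 1))"
    then have z: "z \<noteq> v n" by simp
    then have adj: "(v n, z) \<in> E" using Suc.prems top_push_nonadj[of z "v n"] pile by force
    then have "top_bead ?r z \<noteq> None" using Suc.prems pile top_push_adj[OF adj] by simp
    then have "n > 0" "z = v (n - 1)" using Suc.IH by auto
    then show False using v_step(2)[of "n - 1"] adj E_sym by auto
  qed
qed

lemma top_pile_walk_next: "top_bead (pile (walk_word n)) (v n) = None"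
proof (rule ccontr)
  assume "top_bead (pile (walk_word n)) (v n) \<noteq> None"
  then show False using top_pile_walk[of n "v n"] v_step(1)[of "n - 1"] by auto
qed

lemma pile_walk_Suc: "pile (walk_word (Suc n)) = push (v n) (b (v n)) (pile (walk_word n))"
  unfolding walk_word_Suc pile_snoc using top_pile_walk_next[of n] by (simp add: act_push)

lemma pile_walk_mono: "m \<le> n \<Longrightarrow> bead_le (pile (walk_word m)) (pile (walk_word n))"
proof (induction n rule: dec_induct)
  case base
  show ?case by (rule bead_le_refl)
next
  case (step n)
  then show ?case unfolding pile_walk_Suc using bead_le_push bead_le_trans by blast
qed

lemma pile_walk_not_le: "\<not> bead_le (pile (walk_word (Suc n))) (pile [])"
proof
  assume "bead_le (pile (walk_word (Suc n))) (pile [])"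
  then have "suffix (push (v n) (b (v n)) (pile (walk_word n)) (v n)) []"
    unfolding bead_le_def pile_walk_Suc by (simp add: pile_def)
  then show False by (simp add: push_def)
qed

lemma exponent_walk: "letter_sign (b u) * exponent u (walk_word n) = int (card {i. i < n \<and> v i = u})"
proof (induction n)
  case (Suc n)
  have "{i. i < Suc n \<and> v i = u} = {i. i < n \<and> v i = u} \<union> (if v n = u then {n} else {})"
    using less_Suc_eq by auto
  then show ?case using Suc
    by (cases "v n = u") (auto simp: walk_word_Suc letter_sign_def algebra_simps)
qed (simp add: walk_word_def)

lemma period_mult: "v (i + m * k) = v i"
proof (induction m)
  case (Suc m)
  then show ?case using period[of "i + m * k"] by (simp add: ac_simps)
qed simp

lemma visits:
  assumes "u \<in> V"
  obtains j where "i * k < j" "j \<le> i * k + k" "v (j - 1) = u" "i < card {l. l < j \<and> v l = u}"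
proof -
  obtain a where a: "a < k" "v a = u" using covers[OF assms] by blast
  \<comment> \<open>Prefixes are indexed by length: \<open>walk_word j\<close> ends with the letter
    at position \<open>j - 1 = a + i * k\<close>, by which \<open>u\<close> has been visited at
    least \<open>i + 1\<close> times.\<close>
  define j where "j = Suc (a + i * k)"
  let ?f = "\<lambda>m. a + m * k"
  have "?f ` {..i} \<subseteq> {l. l < j \<and> v l = u}"
    using a by (auto simp: j_def period_mult less_Suc_eq_le)
  then have "card (?f ` {..i}) \<le> card {l. l < j \<and> v l = u}" by (intro card_mono) auto
  moreover have "inj_on ?f {..i}" using a by (auto simp: inj_on_def)
  ultimately have "i < card {l. l < j \<and> v l = u}" by (simp add: card_image)
  then show ?thesis using that[of j] a by (auto simp: j_def period_mult)
qed

lemma exponent_lipschitz: "\<bar>exponent u w\<bar> \<le> int (length w)"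
  by (induction w) (auto simp: letter_sign_def)

text \<open>Each period of the walk has to be crossed at bounded height, although its walls are only
  crossed at points where all exponents are large. So the \<open>i\<close>-th period costs at least \<open>i - K\<close>
  letters.\<close>

theorem walk_length_bound:
  fixes ht :: "'v \<Rightarrow> int" and K :: nat
  assumes w: "w \<in> gwords V"
    and le: "bead_le (pile (walk_word (n * k))) (pile w)"
    and ht: "\<And>u. u \<in> V \<Longrightarrow> ht u * letter_sign (b u) > 0"
    and height: "\<And>t. (\<Sum>u\<in>V. ht u * exponent u (take t w)) \<le> int K"
  shows "int n * int n - 2 * int K * int n \<le> 2 * int (length w)"
proof -
  \<comment> \<open>The first entry of \<open>w\<close> into the half-space of the
    \<open>j\<close>-th prefix; by minimality the preceding point lies outside, as
    \<open>crossing\<close> requires.\<close>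
  define T where "T j = (LEAST t. bead_le (pile (walk_word j)) (pile (take t w)))" for j
  have reach: "bead_le (pile (walk_word j)) (pile (take (length w) w))" if "j \<le> n * k" for j
    using bead_le_trans[OF pile_walk_mono[OF that] le] by simp
  have T: "bead_le (pile (walk_word j)) (pile (take (T j) w))" if "j \<le> n * k" for j
    unfolding T_def by (rule LeastI[of _ "length w"]) (rule reach[OF that])
  have T_le: "T j \<le> t" if "bead_le (pile (walk_word j)) (pile (take t w))" for j t
    unfolding T_def using that by (rule Least_le)
  have T_len: "T j \<le> length w" if "j \<le> n * k" for j using T_le reach[OF that] .
  have T_mono: "T i \<le> T j" if "i \<le> j" "j \<le> n * k" for i j
    using T_le bead_le_trans[OF pile_walk_mono[OF that(1)] T[OF that(2)]] .
  have take: "take t w \<in> gwords V" for t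
    using w set_take_subset[of t w] by (auto simp: gwords_def)
  have T_exp: "letter_sign (b (v (j - 1))) * exponent (v (j - 1)) (take (T j) w)
      = int (card {l. l < j \<and> v l = v (j - 1)})" if j: "0 < j" "j \<le> n * k" for j
  proof -
    obtain j' where j': "j = Suc j'" using j(1) gr0_conv_Suc by blast
    have "T j \<noteq> 0"
    proof
      assume "T j = 0"
      then have "bead_le (pile (walk_word j)) (pile [])" using T[OF j(2)] by simp
      then show False using pile_walk_not_le[of j'] j' by simp
    qed
    then obtain t where t: "T j = Suc t" using not0_implies_Suc by blast
    have "t < length w" using T_len[OF j(2)] t by simp
    then have take_t: "take (Suc t) w = take t w @ [w ! t]" by (rule take_Suc_conv_app_nth)
    obtain u c where uc: "w ! t = (u, c)" by (cases "w ! t")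
    have "w ! t \<in> V \<times> UNIV" using w \<open>t < length w\<close> by (auto simp: gwords_def)
    then have u: "u \<in> V" using uc by simp
    have "act (pile (take t w)) (u, c) (v j') = pile (walk_word j) (v j')"
    proof (rule crossing)
      show "valid (pile (walk_word j))" "valid (pile (take t w))"
        using valid_pile walk_word_gwords take by auto
      show "z = v j'" if "top_bead (pile (walk_word j)) z \<noteq> None" for z
        using top_pile_walk[OF that] j' by simp
      show "\<not> bead_le (pile (walk_word j)) (pile (take t w))"
        using T_le[of j t] t by auto
      show "bead_le (pile (walk_word j)) (act (pile (take t w)) (u, c))"
        using T[OF j(2)] t take_t uc by (simp add: pile_snoc)
    qed (rule u)
    then have "pile (take (T j) w) (v j') = pile (walk_word j) (v j')"
      using t take_t uc by (simp add: pile_snoc)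
    then have "exponent (v j') (take (T j) w) = exponent (v j') (walk_word j)"
      using bead_sum_pile[OF take, of "T j" "v j'"] bead_sum_pile[OF walk_word_gwords, of j "v j'"] by simp
    then show ?thesis using exponent_walk[of "v j'" j] j' by simp
  qed
  have gain: "int (T (Suc i * k)) \<ge> int (T (i * k)) + (int i + 1 - int K)" if i: "i < n" for i
  proof -
    have ik: "Suc i * k \<le> n * k" using i by (intro mult_le_mono1) simp
    let ?t = "T (i * k)"
    \<comment> \<open>If every signed exponent exceeded \<open>K\<close>, every summand of the
      height would exceed \<open>K\<close>, and so would the height.\<close>
    have "\<exists>u\<in>V. letter_sign (b u) * exponent u (take ?t w) \<le> int K"
    proof (rule ccontr)
      assume "\<not> ?thesis"
      then have *: "letter_sign (b u) * exponent u (take ?t w) > int K" if "u \<in> V" for u using that by force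
      have "int K < ht u * exponent u (take ?t w)" if u: "u \<in> V" for u
      proof -
        have eq: "ht u * exponent u (take ?t w) = (ht u * letter_sign (b u)) * (letter_sign (b u) * exponent u (take ?t w))"
          by (simp add: letter_sign_def)
        have "1 * (letter_sign (b u) * exponent u (take ?t w))
            \<le> (ht u * letter_sign (b u)) * (letter_sign (b u) * exponent u (take ?t w))"
          using ht[OF u] *[OF u] by (intro mult_right_mono) auto
        then show ?thesis using eq *[OF u] by linarith
      qed
      note big = this
      have "int K < ht (v 0) * exponent (v 0) (take ?t w)" using big v_in by blast
      also have "\<dots> \<le> (\<Sum>u\<in>V. ht u * exponent u (take ?t w))"
        using big finite_V v_in by (intro member_le_sum) force+
      finally show False using height[of ?t] by simp
    qed
    then obtain u where u: "u \<in> V" "letter_sign (b u) * exponent u (take ?t w) \<le> int K" by blast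
    obtain j where j: "i * k < j" "j \<le> i * k + k" "v (j - 1) = u" "i < card {l. l < j \<and> v l = u}"
      using visits[OF u(1)] by blast
    have jn: "j \<le> n * k" using j ik by simp
    have "0 < j" using j by simp
    \<comment> \<open>At this wall the signed exponent of \<open>u\<close> equals the number of
      visits so far, while it was at most \<open>K\<close> at the start of the period; one letter
      alters an exponent by at most one.\<close>
    have "int i + 1 \<le> letter_sign (b u) * exponent u (take (T j) w)"
      using T_exp[OF \<open>0 < j\<close> jn] j by simp
    moreover have "T j \<ge> ?t" using T_mono[of "i * k" j] j jn by simp
    then have "take (T j) w = take ?t w @ take (T j - ?t) (drop ?t w)"
      by (metis le_add_diff_inverse take_add)
    then have "exponent u (take (T j) w) - exponent u (take ?t w) = exponent u (take (T j - ?t) (drop ?t w))"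
      by simp
    then have "\<bar>exponent u (take (T j) w) - exponent u (take ?t w)\<bar> \<le> int (T j - ?t)"
      using exponent_lipschitz[of u "take (T j - ?t) (drop ?t w)"] by simp
    ultimately have "int i + 1 - int K \<le> int (T j) - int ?t"
      using u(2) \<open>T j \<ge> ?t\<close> by (cases "b u") (auto simp: letter_sign_def of_nat_diff)
    moreover have "T j \<le> T (Suc i * k)" using T_mono[OF _ ik, of j] j by (simp add: add.commute)
    ultimately show ?thesis by simp
  qed
  \<comment> \<open>The sum of \<open>i + 1 - K\<close> over \<open>i < m\<close> is
    \<open>m * (m + 1) / 2 - K * m\<close>; doubling avoids the division.\<close>
  have "int m * int m - 2 * int K * int m \<le> 2 * int (T (m * k))" if "m \<le> n" for m
    using that
  proof (induction m)
    case (Suc m)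
    then have "int m * int m - 2 * int K * int m \<le> 2 * int (T (m * k))" by simp
    moreover have "int (T (Suc m * k)) \<ge> int (T (m * k)) + (int m + 1 - int K)"
      using gain Suc.prems by simp
    ultimately show ?case by (simp add: algebra_simps)
  qed simp
  from this[of n] show ?thesis using T_len[of "n * k"] by linarith
qed

end

section \<open>Right-angled Artin groups and the lower bound\<close>

locale raag_character =
  fixes \<Gamma> :: "'v pair_pre_digraph" and p :: "'v gword set \<Rightarrow> int"
  assumes graph: "pair_graph \<Gamma>"
    and hom_p: "p \<in> hom (raag \<Gamma>) integer_group"
begin

abbreviation V where "V \<equiv> pverts \<Gamma>"
abbreviation E where "E \<equiv> parcs \<Gamma>"
abbreviation gen where "gen \<equiv> raag_gen \<Gamma>"

abbreviation cong where
  "cong \<equiv> pres_cong V {([(s, True), (t, True)], [(t, True), (s, True)]) | s t. (s, t) \<in> E}"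

definition cls :: "'v gword \<Rightarrow> 'v gword set" where
  "cls w = cong `` {w}"

sublocale group "raag \<Gamma>"
  by (rule group_raag)

sublocale pilings V E
proof -
  interpret pair_graph \<Gamma> by (rule graph)
  show "pilings V E"
  proof
    show "(v, u) \<in> E" if "(u, v) \<in> E" for u v
      using that arcs_symmetric by blast
    show "(u, u) \<notin> E" for u using pair_no_loops by fastforce
  qed (rule pair_finite_verts)
qed

lemma E_in_V: "(u, v) \<in> E \<Longrightarrow> u \<in> V \<and> v \<in> V"
proof -
  interpret pair_graph \<Gamma> by (rule graph)
  show "(u, v) \<in> E \<Longrightarrow> u \<in> V \<and> v \<in> V" using in_arcsD1 in_arcsD2 by blast
qed

lemma gwords_append [simp]: "w @ w' \<in> gwords V \<longleftrightarrow> w \<in> gwords V \<and> w' \<in> gwords V"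
  by (auto simp: gwords_def)

lemma gwords_Cons [simp]: "l # w \<in> gwords V \<longleftrightarrow> fst l \<in> V \<and> w \<in> gwords V"
  by (cases l) (auto simp: gwords_def)

lemma gwords_Nil [simp]: "[] \<in> gwords V"
  by (simp add: gwords_def)

lemma carrier_eq: "carrier (raag \<Gamma>) = cls ` gwords V"
  by (auto simp: raag_def presented_group_def quotient_def cls_def)

lemma cls_closed [simp]: "w \<in> gwords V \<Longrightarrow> cls w \<in> carrier (raag \<Gamma>)"
  by (simp add: carrier_eq)

lemma cls_append: "w \<in> gwords V \<Longrightarrow> w' \<in> gwords V \<Longrightarrow> cls (w @ w') = cls w \<otimes>\<^bsub>raag \<Gamma>\<^esub> cls w'"
  by (simp add: cls_def raag_def presented_group_mult)

lemma cls_Nil: "cls [] = \<one>\<^bsub>raag \<Gamma>\<^esub>"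
  by (simp add: cls_def raag_def presented_group_def)

lemma cls_eqD: "w \<in> gwords V \<Longrightarrow> w' \<in> gwords V \<Longrightarrow> cls w = cls w' \<Longrightarrow> (w, w') \<in> cong"
  unfolding cls_def by (rule eq_equiv_class[OF _ equiv_pres_cong])

lemma cls_gen: "cls [(u, True)] = gen u"
  by (simp add: cls_def raag_gen_def)

lemma gen_closed [simp]: "u \<in> V \<Longrightarrow> gen u \<in> carrier (raag \<Gamma>)"
  by (rule raag_gen_closed)

lemma cls_inv:
  assumes "u \<in> V"
  shows "cls [(u, False)] = inv\<^bsub>raag \<Gamma>\<^esub> gen u"
proof -
  have "(gword_inv [(u, True)] @ [(u, True)], []) \<in> cong"
    using assms by (intro gword_inv_cancel) simp
  then have "cls ([(u, False)] @ [(u, True)]) = cls []"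
    unfolding cls_def using equiv_class_eq[OF equiv_pres_cong] by (simp add: gword_inv_def)
  then have "cls [(u, False)] \<otimes>\<^bsub>raag \<Gamma>\<^esub> gen u = \<one>\<^bsub>raag \<Gamma>\<^esub>"
    using assms cls_append[of "[(u, False)]" "[(u, True)]"] by (simp add: cls_Nil cls_gen)
  then show ?thesis using assms inv_equality by simp
qed

lemma cls_letter: "u \<in> V \<Longrightarrow> cls [(u, c)] \<in> gen ` V \<union> m_inv (raag \<Gamma>) ` gen ` V"
  using cls_gen cls_inv by (cases c) auto

lemma gens_closed: "gen ` V \<subseteq> carrier (raag \<Gamma>)"
  by auto

lemma cls_word_ball: "w \<in> gwords V \<Longrightarrow> cls w \<in> word_ball (gen ` V) (length w)"
proof (induction w)
  case (Cons l w)
  obtain u c where l: "l = (u, c)" by (cases l)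
  have "cls [(u, c)] \<otimes>\<^bsub>raag \<Gamma>\<^esub> cls w \<in> word_ball (gen ` V) (1 + length w)"
    using Cons l incl_word_ball[OF gens_closed cls_letter[of u c], of 1]
    by (intro mult_word_ball gens_closed) auto
  then show ?case using Cons.prems l cls_append[of "[(u, c)]" w] by simp
qed (simp add: cls_Nil)

lemma generate_gens: "generate (raag \<Gamma>) (gen ` V) = carrier (raag \<Gamma>)"
proof
  show "generate (raag \<Gamma>) (gen ` V) \<subseteq> carrier (raag \<Gamma>)"
    using generate_in_carrier[OF gens_closed] by blast
  show "carrier (raag \<Gamma>) \<subseteq> generate (raag \<Gamma>) (gen ` V)"
    using cls_word_ball generate_eq_word_balls[OF gens_closed] by (auto simp: carrier_eq)
qed

sublocale int_hom "raag \<Gamma>" p "gen ` V"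
  using hom_p gens_closed generate_gens finite_V by unfold_locales auto

text \<open>The image under \<open>p\<close> of the spelled element (\<open>p_cls\<close>), written
  through exponents because these can be read off from pilings.\<close>

definition height :: "'v gword \<Rightarrow> int" where
  "height w = (\<Sum>u\<in>V. p (gen u) * exponent u w)"

lemma height_append: "height (w @ w') = height w + height w'"
  by (simp add: height_def sum.distrib algebra_simps)

lemma height_Nil [simp]: "height [] = 0"
  by (simp add: height_def)

lemma height_letter: "u \<in> V \<Longrightarrow> height [(u, c)] = p (gen u) * letter_sign c"
  using finite_V by (simp add: height_def if_distrib[of "\<lambda>x. _ * x"] sum.delta cong: if_cong)

lemma p_cls: "w \<in> gwords V \<Longrightarrow> p (cls w) = height w"
proof (induction w)
  case (Cons l w)
  obtain u c where l: "l = (u, c)" by (cases l)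
  have u: "u \<in> V" using Cons.prems l by simp
  have "p (cls [(u, c)]) = height [(u, c)]"
    using u by (cases c) (simp_all add: cls_gen cls_inv height_letter letter_sign_def)
  then show ?case
    using Cons l u cls_append[of "[(u, c)]" w] height_append[of "[(u, c)]" w] by simp
qed (simp add: cls_Nil)

lemma height_bound: "\<bar>height w\<bar> \<le> (\<Sum>u\<in>V. \<bar>p (gen u)\<bar>) * int (length w)"
proof -
  have lip: "\<bar>exponent u w\<bar> \<le> int (length w)" for u
    by (induction w) (auto simp: letter_sign_def)
  have "\<bar>height w\<bar> \<le> (\<Sum>u\<in>V. \<bar>p (gen u) * exponent u w\<bar>)"
    unfolding height_def by (rule sum_abs)
  also have "\<dots> \<le> (\<Sum>u\<in>V. \<bar>p (gen u)\<bar> * int (length w))"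
    using lip by (intro sum_mono) (simp add: abs_mult mult_left_mono)
  finally show ?thesis by (simp add: sum_distrib_right)
qed

text \<open>Each letter over \<open>T\<close> is spelled by a fixed word of length at most
  \<open>R\<close> and of height 0. A prefix of the concatenation consists of complete blocks, of
  height 0, and at most one started block; so \<open>K\<close> does not depend on
  \<open>n\<close>.\<close>

lemma spell_kernel_word:
  assumes T: "finite T" "T \<subseteq> N"
  obtains R K where "\<And>h n. h \<in> word_ball T n \<Longrightarrow>
    \<exists>w\<in>gwords V. cls w = h \<and> length w \<le> R * n \<and> (\<forall>t. height (take t w) \<le> int K)"
proof -
  let ?Y = "T \<union> m_inv (raag \<Gamma>) ` T"
  have Y: "y \<in> carrier (raag \<Gamma>) \<and> p y = 0" if "y \<in> ?Y" for y
    using that T(2) by (auto simp: N_iff)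
  have "\<forall>y\<in>?Y. \<exists>w. w \<in> gwords V \<and> cls w = y"
  proof
    fix y assume "y \<in> ?Y"
    then have "y \<in> cls ` gwords V" using Y carrier_eq by blast
    then show "\<exists>w. w \<in> gwords V \<and> cls w = y" by auto
  qed
  then obtain r where r: "\<And>y. y \<in> ?Y \<Longrightarrow> r y \<in> gwords V \<and> cls (r y) = y" by metis
  \<comment> \<open>\<open>insert 0\<close> keeps the set nonempty when \<open>T\<close> is
    empty.\<close>
  define R where "R = Max (insert 0 (length ` r ` ?Y))"
  have R: "length (r y) \<le> R" if "y \<in> ?Y" for y
    unfolding R_def using that T(1) by (intro Max_ge) auto
  define P where "P = (\<Sum>u\<in>V. \<bar>p (gen u)\<bar>)"
  have "P \<ge> 0" unfolding P_def by (intro sum_nonneg) auto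
  define K where "K = nat (P * int R)"
  show ?thesis
  proof (rule that[of R K])
    fix h n assume "h \<in> word_ball T n"
    then obtain ns where ns: "h = lprod ns" "length ns \<le> n" "set ns \<subseteq> ?Y" by (rule word_ballE)
    let ?w = "concat (map r ns)"
    have "?w \<in> gwords V \<and> cls ?w = lprod ns \<and> length ?w \<le> R * length ns \<and>
        (\<forall>t. height (take t ?w) \<le> int K)"
      using ns(3)
    proof (induction ns)
      case Nil
      then show ?case by (simp add: cls_Nil)
    next
      case (Cons y ns)
      let ?v = "concat (map r ns)"
      have IH: "?v \<in> gwords V" "cls ?v = lprod ns" "length ?v \<le> R * length ns"
        "\<And>t. height (take t ?v) \<le> int K" using Cons by auto
      have y: "y \<in> ?Y" using Cons.prems by simp
      note ry = r[OF y]
      have "height (take t (r y @ ?v)) \<le> int K" for t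
      proof (cases "t \<le> length (r y)")
        case True
        then have "length (take t (r y)) \<le> R" using R[OF y] by simp
        then have "P * int (length (take t (r y))) \<le> P * int R"
          using \<open>P \<ge> 0\<close> by (intro mult_left_mono) auto
        then show ?thesis
          using height_bound[of "take t (r y)"] True \<open>P \<ge> 0\<close> by (simp add: K_def P_def)
      next
        case False
        have "height (r y) = 0" using p_cls[of "r y"] ry Y[OF y] by simp
        then show ?thesis using False IH(4)[of "t - length (r y)"] by (simp add: height_append)
      qed
      moreover have "length (r y @ ?v) \<le> R * length (y # ns)" using R[OF y] IH(3) by simp
      moreover have "cls (r y @ ?v) = lprod (y # ns)" using cls_append ry IH by simp
      ultimately show ?case using ry IH(1) by simp
    qed
    moreover have "R * length ns \<le> R * n" using ns(2) by simp
    ultimately show "\<exists>w\<in>gwords V. cls w = h \<and> length w \<le> R * n \<and> (\<forall>t. height (take t w) \<le> int K)"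
      using ns(1) by (meson order_trans)
  qed
qed

end

section \<open>Closed walks through all vertices\<close>

lemma rtrancl_imp_walk:
  "(x, y) \<in> C\<^sup>* \<Longrightarrow> \<exists>zs. successively (\<lambda>a b. (a, b) \<in> C) (x # zs) \<and> last (x # zs) = y"
proof (induction rule: rtrancl_induct)
  case base
  show ?case by (rule exI[of _ "[]"]) simp
next
  case (step y z)
  then obtain zs where zs: "successively (\<lambda>a b. (a, b) \<in> C) (x # zs)" "last (x # zs) = y" by blast
  have "successively (\<lambda>a b. (a, b) \<in> C) ((x # zs) @ [z])"
    using zs step.hyps(2) by (subst successively_append_iff) auto
  then show ?case by (intro exI[of _ "zs @ [z]"]) simp
qed

text \<open>All walks start and end at \<open>x\<close>; a further vertex is included by a detour
  from \<open>x\<close> and back.\<close>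

lemma covering_walk:
  assumes conn: "\<And>x y. x \<in> V \<Longrightarrow> y \<in> V \<Longrightarrow> (x, y) \<in> C\<^sup>*"
    and x: "x \<in> V" and A: "finite A" "A \<subseteq> V"
  shows "\<exists>zs. successively (\<lambda>a b. (a, b) \<in> C) (x # zs) \<and> last (x # zs) = x \<and> A \<subseteq> set (x # zs)"
  using A
proof (induction A rule: finite_induct)
  case empty
  show ?case by (rule exI[of _ "[]"]) simp
next
  case (insert a A)
  let ?s = "successively (\<lambda>a b. (a, b) \<in> C)"
  have join: "?s (x # zs @ ws)" if "?s (x # zs)" "?s (y # ws)" "last (x # zs) = y" for x y zs ws
  proof -
    have "?s ((x # zs) @ ws)"
      using that by (subst successively_append_iff) (cases ws; auto)
    then show ?thesis by simp
  qed
  obtain zs where zs: "?s (x # zs)" "last (x # zs) = x" "A \<subseteq> set (x # zs)" using insert by auto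
  have "a \<in> V" using insert.prems by simp
  obtain us where us: "?s (x # us)" "last (x # us) = a"
    using rtrancl_imp_walk[OF conn[OF x \<open>a \<in> V\<close>]] by blast
  obtain ws where ws: "?s (a # ws)" "last (a # ws) = x"
    using rtrancl_imp_walk[OF conn[OF \<open>a \<in> V\<close> x]] by blast
  have "?s (x # us @ ws)" by (rule join[OF us(1) ws(1) us(2)])
  then have "?s (x # zs @ us @ ws)" by (rule join[OF zs(1) _ zs(2)])
  moreover have "last (x # zs @ us @ ws) = x"
  proof -
    have "last (x # us @ ws) = x" using us(2) ws(2) by (cases ws) auto
    then show ?thesis using zs(2) by (cases "us @ ws") auto
  qed
  moreover have "a \<in> set (x # us)" using us(2) last_in_set[of "x # us"] by auto
  ultimately show ?case using zs(3) by (intro exI[of _ "zs @ us @ ws"]) auto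
qed

lemma periodic_walk:
  assumes conn: "\<And>x y. x \<in> V \<Longrightarrow> y \<in> V \<Longrightarrow> (x, y) \<in> C\<^sup>*"
    and V: "finite V" "x \<in> V" "y \<in> V" "x \<noteq> y"
  obtains v :: "nat \<Rightarrow> 'v" and k where "\<And>i. (v i, v (Suc i)) \<in> C" "\<And>i. v (i + k) = v i"
    "\<And>u. u \<in> V \<Longrightarrow> \<exists>i<k. v i = u"
proof -
  obtain zs where zs: "successively (\<lambda>a b. (a, b) \<in> C) (x # zs)" "last (x # zs) = x" "V \<subseteq> set (x # zs)"
    using covering_walk[OF conn V(2,1) order_refl] by blast
  have ne: "zs \<noteq> []" using zs V by auto
  \<comment> \<open>The closing repetition of \<open>x\<close> is dropped, so that indexing modulo
    \<open>k\<close> passes from the last vertex back to \<open>x\<close>. The second vertex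
    \<open>y\<close> makes \<open>k\<close> positive.\<close>
  define ys where "ys = butlast (x # zs)"
  define k where "k = length ys"
  have ys: "x # zs = ys @ [x]" using append_butlast_last_id[of "x # zs"] zs(2) by (simp add: ys_def)
  have k0: "0 < k" using ne by (simp add: k_def ys_def)
  have ys0: "ys ! 0 = x" using ne by (simp add: ys_def)
  define v where "v i = ys ! (i mod k)" for i
  show ?thesis
  proof (rule that[of v k])
    show "(v i, v (Suc i)) \<in> C" for i
    proof -
      let ?j = "i mod k"
      have j: "?j < k" using k0 by simp
      have "((ys @ [x]) ! ?j, (ys @ [x]) ! Suc ?j) \<in> C"
        using zs(1) j unfolding ys successively_conv_nth by (auto simp: k_def)
      moreover have "(ys @ [x]) ! ?j = v i" using j by (simp add: nth_append v_def k_def)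
      moreover have "(ys @ [x]) ! Suc ?j = v (Suc i)"
      proof (cases "Suc ?j = k")
        case True
        then have "Suc i mod k = 0" by (simp add: mod_Suc)
        then show ?thesis using True ys0 by (simp add: v_def k_def)
      next
        case False
        then have "Suc i mod k = Suc ?j" by (simp add: mod_Suc)
        then show ?thesis using False j by (simp add: v_def nth_append k_def)
      qed
      ultimately show ?thesis by simp
    qed
    show "v (i + k) = v i" for i by (simp add: v_def)
    show "\<exists>i<k. v i = u" if "u \<in> V" for u
    proof -
      have "x \<in> set ys" using ys0 k0 nth_mem[of 0 ys] by (simp add: k_def)
      then have "u \<in> set ys" using zs(3) that unfolding ys by auto
      then obtain i where "i < k" "ys ! i = u" by (auto simp: in_set_conv_nth k_def)
      then show ?thesis by (intro exI[of _ i]) (simp add: v_def)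
    qed
  qed
qed

section \<open>The quadratic lower bound\<close>

context raag_character
begin

definition co_edges :: "('v \<times> 'v) set" where
  "co_edges = {(u, w). u \<in> V \<and> w \<in> V \<and> u \<noteq> w \<and> (u, w) \<notin> E}"

text \<open>If \<open>y\<close> cannot be reached, let \<open>A\<close> be the component of
  \<open>x\<close> in the complement graph and \<open>B\<close> the rest. No complement edge joins
  them, so all pairs between them are in \<open>E\<close>, and the graph is the join of the two
  induced subgraphs.\<close>

lemma complement_connected:
  assumes "\<not> is_join \<Gamma>" "x \<in> V" "y \<in> V"
  shows "(x, y) \<in> co_edges\<^sup>*"
proof (rule ccontr)
  assume xy: "(x, y) \<notin> co_edges\<^sup>*"
  interpret pair_graph \<Gamma> by (rule graph)
  define A where "A = {z \<in> V. (x, z) \<in> co_edges\<^sup>*}"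
  define B where "B = V - A"
  have AB: "(a, b) \<in> E" if "a \<in> A" "b \<in> B" for a b
  proof (rule ccontr)
    assume "(a, b) \<notin> E"
    then have "(a, b) \<in> co_edges" using that by (auto simp: A_def B_def co_edges_def)
    then show False using that by (auto simp: A_def B_def intro: rtrancl.rtrancl_into_rtrancl)
  qed
  define G1 where "G1 = \<lparr>pverts = A, parcs = {(u, w) \<in> E. u \<in> A \<and> w \<in> A}\<rparr>"
  define G2 where "G2 = \<lparr>pverts = B, parcs = {(u, w) \<in> E. u \<in> B \<and> w \<in> B}\<rparr>"
  have ind: "pair_graph \<lparr>pverts = W, parcs = {(u, w) \<in> E. u \<in> W \<and> w \<in> W}\<rparr>
      \<and> subgraph \<lparr>pverts = W, parcs = {(u, w) \<in> E. u \<in> W \<and> w \<in> W}\<rparr> \<Gamma>" (is "pair_graph ?H \<and> _")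
    if W: "W \<subseteq> V" for W
  proof
    show "pair_graph ?H"
    proof
      show "finite (pverts ?H)" using W finite_V by (auto intro: finite_subset)
      show "finite (parcs ?H)" by (rule rev_finite_subset[OF pair_finite_arcs]) auto
      show "symmetric (with_proj ?H)"
        using E_sym by (auto simp: symmetric_def intro!: symI)
      show "fst e \<noteq> snd e" if "e \<in> parcs ?H" for e using that E_irrefl by auto
    qed auto
    then interpret H: pair_graph ?H .
    show "subgraph ?H \<Gamma>"
      unfolding subgraph_def using W H.wf_digraph wf_digraph by (auto simp: compatible_def)
  qed
  have "\<Gamma> = graph_join G1 G2"
  proof -
    have "pverts (graph_join G1 G2) = V" by (auto simp: graph_join_def G1_def G2_def A_def B_def)
    moreover have "parcs (graph_join G1 G2) = E"
    proof (rule Set.set_eqI)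
      fix e :: "'v \<times> 'v"
      obtain u w where e: "e = (u, w)" by (cases e)
      have "u \<in> B \<Longrightarrow> w \<in> A \<Longrightarrow> (u, w) \<in> E" using AB E_sym by blast
      moreover have "(u, w) \<in> E \<Longrightarrow> u \<in> A \<union> B \<and> w \<in> A \<union> B" using E_in_V by (auto simp: B_def)
      ultimately show "e \<in> parcs (graph_join G1 G2) \<longleftrightarrow> e \<in> E"
        using AB[of u w] by (auto simp: graph_join_def G1_def G2_def e)
    qed
    ultimately show ?thesis by (metis pair_pre_digraph.surjective old.unit.exhaust)
  qed
  moreover have "pair_graph G1" "subgraph G1 \<Gamma>" "pair_graph G2" "subgraph G2 \<Gamma>"
    using ind[of A] ind[of B] by (auto simp: G1_def G2_def A_def B_def)
  moreover have "pverts G1 \<noteq> {}" "pverts G2 \<noteq> {}" "pverts G1 \<inter> pverts G2 = {}"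
    using assms xy by (auto simp: G1_def G2_def A_def B_def)
  ultimately have "is_join \<Gamma>" unfolding is_join_def by blast
  then show False using assms by simp
qed

theorem kernel_lower_bound:
  assumes nj: "\<not> is_join \<Gamma>" and card: "card V \<ge> 2"
    and nz: "\<And>u. u \<in> V \<Longrightarrow> p (gen u) \<noteq> 0"
    and T: "finite T" "T \<subseteq> N"
  obtains c a d where "\<And>n. \<exists>h\<in>N. h \<in> word_ball (gen ` V) (c * n) \<and>
    (\<forall>l. h \<in> word_ball T l \<longrightarrow> n\<^sup>2 \<le> a * l + d * n)"
proof -
  obtain x y where xy: "x \<in> V" "y \<in> V" "x \<noteq> y"
    using card card_le_Suc0_iff_eq[OF finite_V] by fastforce
  obtain v k where v: "\<And>i. (v i, v (Suc i)) \<in> co_edges" "\<And>i. v (i + k) = v i"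
    "\<And>u. u \<in> V \<Longrightarrow> \<exists>i<k. v i = u"
    using periodic_walk[OF complement_connected[OF nj] finite_V xy] by blast
  \<comment> \<open>With these signs every letter of the walk raises the height.\<close>
  define b where "b u \<longleftrightarrow> p (gen u) > 0" for u
  interpret complement_walk V E v k b
  proof unfold_locales
    fix i
    show "v i \<in> V" "v (Suc i) \<noteq> v i" "(v i, v (Suc i)) \<notin> E"
      using v(1)[of i] by (auto simp: co_edges_def)
  qed (use v in auto)
  have pos: "p (gen u) * letter_sign (b u) > 0" if "u \<in> V" for u
    using nz[OF that] by (auto simp: b_def letter_sign_def)
  define P where "P = height (walk_word k)"
  have "P \<ge> 0" unfolding P_def height_def
  proof (intro sum_nonneg)
    fix u assume u: "u \<in> V"
    have "p (gen u) * exponent u (walk_word k)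
        = (p (gen u) * letter_sign (b u)) * (letter_sign (b u) * exponent u (walk_word k))"
      by (simp add: letter_sign_def)
    moreover have "0 \<le> (p (gen u) * letter_sign (b u)) * (letter_sign (b u) * exponent u (walk_word k))"
      by (rule mult_nonneg_nonneg) (use pos[OF u] exponent_walk[of u k] in auto)
    ultimately show "0 \<le> p (gen u) * exponent u (walk_word k)" by (simp only:)
  qed
  have walk_mult: "height (walk_word (m * k)) = int m * P" for m
  proof (induction m)
    case 0
    then show ?case by (simp add: walk_word_def)
  next
    case (Suc m)
    have "walk_word (Suc m * k) = walk_word (m * k) @ walk_word k"
    proof -
      have "[0..<Suc m * k] = [0..<m * k] @ map (\<lambda>i. i + m * k) [0..<k]"
        using upt_add_eq_append[of 0 "m * k" k] by (simp add: map_add_upt add.commute)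
      then show ?thesis by (simp add: walk_word_def period_mult o_def)
    qed
    then show ?case using Suc by (simp add: height_append P_def algebra_simps)
  qed
  \<comment> \<open>One period has height \<open>P\<close>, and one letter at \<open>v 0\<close>
    changes the height by \<open>\<mu>\<close>. So \<open>n * \<mu>\<close> periods are balanced by
    \<open>n * nat P\<close> letters at \<open>v 0\<close> of opposite sign.\<close>
  define \<mu> where "\<mu> = nat \<bar>p (gen (v 0))\<bar>"
  have "\<mu> > 0" using nz[OF v_in] by (simp add: \<mu>_def)
  define W where "W n = walk_word (n * \<mu> * k) @ replicate (n * nat P) (v 0, \<not> b (v 0))" for n
  have W: "W n \<in> gwords V" for n
    using walk_word_gwords v_in by (auto simp: W_def gwords_def)
  have h_rep: "height (replicate m (v 0, c)) = int m * (p (gen (v 0)) * letter_sign c)" for m c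
  proof (induction m)
    case (Suc m)
    then show ?case using height_append[of "[(v 0, c)]" "replicate m (v 0, c)"] height_letter[OF v_in]
      by (simp add: algebra_simps)
  qed simp
  have "p (gen (v 0)) * letter_sign (\<not> b (v 0)) = - int \<mu>"
    by (auto simp: b_def letter_sign_def \<mu>_def)
  then have "height (W n) = 0" for n
    using \<open>P \<ge> 0\<close> by (simp add: W_def height_append walk_mult h_rep)
  then have hN: "cls (W n) \<in> N" for n using W p_cls by (simp add: N_iff)
  obtain R K where RK: "\<And>h n. h \<in> word_ball T n \<Longrightarrow>
    \<exists>w\<in>gwords V. cls w = h \<and> length w \<le> R * n \<and> (\<forall>t. height (take t w) \<le> int K)"
    using spell_kernel_word[OF T] by blast
  \<comment> \<open>After whole periods the walk would continue with \<open>v 0\<close>, whose stack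
    has no bead on top. So the balancing letters do not cancel, and the endpoint stays in the last
    half-space.\<close>
  have pile_W: "bead_le (pile (walk_word (n * \<mu> * k))) (pile (W n))" for n
  proof -
    have "v (n * \<mu> * k) = v 0" using period_mult[of 0 "n * \<mu>"] by simp
    then have "top_bead (pile (walk_word (n * \<mu> * k))) (v 0) = None"
      using top_pile_walk_next[of "n * \<mu> * k"] by simp
    then show ?thesis
      using bead_le_replicate[of _ "v 0" "\<not> b (v 0)"] by (simp add: W_def pile_def)
  qed
  show ?thesis
  proof (rule that[of "\<mu> * k + nat P" "2 * R" "2 * K * \<mu>"])
    fix n
    have "length (W n) = (\<mu> * k + nat P) * n"
      by (simp add: W_def walk_word_def algebra_simps)
    then have "cls (W n) \<in> word_ball (gen ` V) ((\<mu> * k + nat P) * n)"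
      using cls_word_ball[OF W] by metis
    moreover have "n\<^sup>2 \<le> 2 * R * l + 2 * K * \<mu> * n" if l: "cls (W n) \<in> word_ball T l" for l
    proof -
      obtain w where w: "w \<in> gwords V" "cls w = cls (W n)" "length w \<le> R * l"
        "\<And>t. height (take t w) \<le> int K" using RK[OF l] by blast
      have "pile w = pile (W n)" using pile_cong cls_eqD w W by blast
      then have "bead_le (pile (walk_word (n * \<mu> * k))) (pile w)" using pile_W by simp
      then have "int (n * \<mu>) * int (n * \<mu>) - 2 * int K * int (n * \<mu>) \<le> 2 * int (length w)"
        using walk_length_bound[OF w(1), of "n * \<mu>" "\<lambda>u. p (gen u)" K] pos w(4)
        by (simp add: height_def)
      then have "int ((n * \<mu>) * (n * \<mu>)) \<le> int (2 * length w + 2 * K * (n * \<mu>))" by simp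
      then have "(n * \<mu>) * (n * \<mu>) \<le> 2 * length w + 2 * K * (n * \<mu>)" by (simp only: of_nat_le_iff)
      also have "\<dots> \<le> 2 * (R * l) + 2 * K * (n * \<mu>)" using w(3) by simp
      finally have "(n * \<mu>) * (n * \<mu>) \<le> 2 * R * l + 2 * K * \<mu> * n" by (simp add: algebra_simps)
      moreover have "n \<le> n * \<mu>" using \<open>\<mu> > 0\<close> by (cases \<mu>) auto
      then have "n\<^sup>2 \<le> (n * \<mu>) * (n * \<mu>)" using mult_le_mono[of n "n * \<mu>" n "n * \<mu>"] by (simp only: power2_eq_square)
      ultimately show ?thesis by (rule order_trans[rotated])
    qed
    ultimately show "\<exists>h\<in>N. h \<in> word_ball (gen ` V) ((\<mu> * k + nat P) * n) \<and>
      (\<forall>l. h \<in> word_ball T l \<longrightarrow> n\<^sup>2 \<le> 2 * R * l + 2 * K * \<mu> * n)"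
      using hN by blast
  qed
qed

end

section \<open>Distortion of the kernel for the given graph\<close>

theorem corollary1p5:
  fixes \<Gamma> :: "'a pair_pre_digraph"
    and p :: "'a gword set \<Rightarrow> int"
  assumes "pair_graph \<Gamma>"
    and "Digraph_Component.connected (with_proj \<Gamma>)"
    and "card (pverts \<Gamma>) \<ge> 2"
    and "p \<in> hom (raag \<Gamma>) integer_group"
    and "N = kernel (raag \<Gamma>) integer_group p"
    and "\<Gamma>' = with_proj \<Gamma> \<restriction> {v \<in> pverts \<Gamma>. p (raag_gen \<Gamma> v) \<noteq> 0}"
    and "Digraph_Component.connected \<Gamma>'"
    and "star \<Gamma>' (with_proj \<Gamma>) = pverts \<Gamma>"
  shows "(\<exists>T. finite_gen_set (raag \<Gamma>) N T) \<and>
    (\<forall>S T. finite_gen_set (raag \<Gamma>) (carrier (raag \<Gamma>)) S \<and> finite_gen_set (raag \<Gamma>) N T \<longrightarrow>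
       at_most_quadratic_growth (distortion (raag \<Gamma>) S N T)) \<and>
    ((\<forall>v\<in>pverts \<Gamma>. p (raag_gen \<Gamma> v) \<noteq> 0) \<longrightarrow>
      (\<forall>S T. finite_gen_set (raag \<Gamma>) (carrier (raag \<Gamma>)) S \<and> finite_gen_set (raag \<Gamma>) N T \<longrightarrow>
         (is_join \<Gamma> \<longrightarrow> linear_growth (distortion (raag \<Gamma>) S N T)) \<and>
         (\<not> is_join \<Gamma> \<longrightarrow> quadratic_growth (distortion (raag \<Gamma>) S N T))))"
proof -
  interpret raag_character \<Gamma> p by (rule raag_character.intro[OF assms(1,4)])
  interpret pair_graph \<Gamma> by (rule assms(1))
  let ?G = "raag \<Gamma>" and ?X = "raag_gen \<Gamma> ` pverts \<Gamma>"
  define V' where "V' = {v \<in> pverts \<Gamma>. p (raag_gen \<Gamma> v) \<noteq> 0}"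
  have \<Gamma>': "\<Gamma>' = with_proj \<Gamma> \<restriction> V'" using assms(6) by (simp add: V'_def)
  have comm: "gen u \<otimes>\<^bsub>?G\<^esub> gen w = gen w \<otimes>\<^bsub>?G\<^esub> gen u" if "(u, w) \<in> parcs \<Gamma>" for u w
    using raag_gen_commute[OF assms(1) that] .
  let ?X' = "{x \<in> ?X. p x \<noteq> 0}"
  let ?R = "{(x, y). x \<in> ?X' \<and> y \<in> ?X' \<and> x \<otimes>\<^bsub>?G\<^esub> y = y \<otimes>\<^bsub>?G\<^esub> x}"
  \<comment> \<open>Connectedness of a digraph means strong connectedness of its symmetric closure;
    it yields paths that stay inside \<open>V'\<close>.\<close>
  have "strongly_connected (mk_symmetric \<Gamma>')"
    using assms(7) by (simp add: connected_def)
  then have sc: "V' \<noteq> {}" "\<And>u v. u \<in> V' \<Longrightarrow> v \<in> V' \<Longrightarrow> u \<rightarrow>\<^sup>*\<^bsub>mk_symmetric \<Gamma>'\<^esub> v"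
    unfolding strongly_connected_def by (auto simp: \<Gamma>' mk_symmetric_def)
  obtain a where a: "a \<in> V'" using sc(1) by blast
  have path: "(gen a, gen v) \<in> ?R\<^sup>*" if v: "v \<in> V'" for v
  proof -
    have "(a, v) \<in> rtrancl_on V' (parcs (mk_symmetric \<Gamma>'))"
      using sc(2)[OF a v] by (simp add: reachable_def \<Gamma>' mk_symmetric_def)
    then show ?thesis
    proof (induction rule: rtrancl_on_induct)
      case (step y z)
      have "(y, z) \<in> parcs \<Gamma>"
        using step.hyps E_sym by (auto simp: \<Gamma>' mk_symmetric_def induce_subgraph_def arcs_ends_def arc_to_ends_def)
      then have "(gen y, gen z) \<in> ?R" using step.hyps comm by (auto simp: V'_def)
      then show ?case using step.IH by (meson rtrancl.rtrancl_into_rtrancl)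
    qed simp
  qed
  have dom: "\<exists>x. (gen a, x) \<in> ?R\<^sup>* \<and> x \<otimes>\<^bsub>?G\<^esub> y = y \<otimes>\<^bsub>?G\<^esub> x" if y: "y \<in> ?X" for y
  proof -
    obtain u where u: "u \<in> pverts \<Gamma>" "y = gen u" using y by auto
    then have "u \<in> star \<Gamma>' (with_proj \<Gamma>)" using assms(8) by simp
    then have "u \<in> V' \<or> (\<exists>w\<in>V'. (u, w) \<in> parcs \<Gamma>)"
      by (auto simp: star_def \<Gamma>')
    \<comment> \<open>A generator commutes with itself, so a vertex of \<open>V'\<close> serves as
      its own \<open>w\<close>.\<close>
    then obtain w where "w \<in> V'" "gen w \<otimes>\<^bsub>?G\<^esub> gen u = gen u \<otimes>\<^bsub>?G\<^esub> gen w"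
      using comm by metis
    then show ?thesis using path u by blast
  qed
  have "gen a \<in> ?X'" using a by (auto simp: V'_def)
  then have "\<exists>C L. \<forall>g\<in>kernel ?G integer_group p. \<forall>n. g \<in> word_ball ?X n \<longrightarrow> g \<in> nprod L (C * (n + 1)\<^sup>2)"
    by (rule kernel_quadratic[OF _ order_refl dom]) blast+
  then obtain C L where quad: "\<And>g n. g \<in> kernel ?G integer_group p \<Longrightarrow> g \<in> word_ball ?X n \<Longrightarrow>
      g \<in> nprod L (C * (n + 1)\<^sup>2)"
    by blast
  have fg: "finite_gen_set ?G N (nball L)"
    unfolding assms(5) by (rule finite_gen_set_nball[OF quad])
  have N: "N \<subseteq> carrier ?G" using assms(5) N_iff by auto
  have upper: "\<exists>C. \<forall>h\<in>N. word_length ?G T h \<le> C * (word_length ?G S h + 1)\<^sup>2"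
    if "finite_gen_set ?G (carrier ?G) S" "finite_gen_set ?G N T" for S T
  proof -
    interpret fg_subgroup ?G S N T using that N by unfold_locales
    show ?thesis
    proof (rule transfer_bound[OF X_closed finite_X generate_X fg])
      show "h \<in> word_ball (nball L) (C * (n + 1)\<^sup>2)" if "h \<in> N" "h \<in> word_ball ?X n" for h n
        using quad[of h n] that unfolding assms(5) nprod_def by simp
    qed
  qed
  have quadratic: "at_most_quadratic_growth (distortion ?G S N T)"
    if ST: "finite_gen_set ?G (carrier ?G) S" "finite_gen_set ?G N T" for S T
  proof -
    interpret fg_subgroup ?G S N T using ST N by unfold_locales
    obtain C where "\<forall>h\<in>N. word_length ?G T h \<le> C * (word_length ?G S h + 1)\<^sup>2"
      using upper[OF ST] by blast
    then show ?thesis by (intro at_most_quadratic_growth_distortion) blast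
  qed
  have linear: "linear_growth (distortion ?G S N T)"
    if nz: "\<forall>v\<in>pverts \<Gamma>. p (gen v) \<noteq> 0" and join: "is_join \<Gamma>"
      and ST: "finite_gen_set ?G (carrier ?G) S" "finite_gen_set ?G N T" for S T
  proof -
    interpret fg_subgroup ?G S N T using ST N by unfold_locales
    obtain G1 G2 where J: "pverts G1 \<noteq> {}" "pverts G2 \<noteq> {}" "\<Gamma> = graph_join G1 G2"
      using join unfolding is_join_def by blast
    have V: "pverts \<Gamma> = pverts G1 \<union> pverts G2" by (subst J(3)) (simp add: graph_join_def)
    have edge: "(u, w) \<in> parcs \<Gamma>" if "u \<in> pverts G1" "w \<in> pverts G2" for u w
      using that by (subst J(3)) (simp add: graph_join_def)
    have c: "x \<otimes>\<^bsub>?G\<^esub> y = y \<otimes>\<^bsub>?G\<^esub> x"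
      if xy: "x \<in> gen ` pverts G1" "y \<in> gen ` pverts G2" for x y
    proof -
      obtain u w where uw: "u \<in> pverts G1" "x = gen u" "w \<in> pverts G2" "y = gen w" using xy by blast
      show ?thesis unfolding uw by (rule comm[OF edge[OF uw(1,3)]])
    qed
    obtain u w where uw: "u \<in> pverts G1" "w \<in> pverts G2" using J by blast
    have X: "?X = gen ` pverts G1 \<union> gen ` pverts G2" using V by auto
    \<comment> \<open>Every vertex has nonzero image, so each factor of the join supplies an element
      to compensate with.\<close>
    have ab: "gen u \<in> gen ` pverts G1" "p (gen u) \<noteq> 0" "gen w \<in> gen ` pverts G2" "p (gen w) \<noteq> 0"
      using uw nz V by auto
    have "\<exists>C L. \<forall>g\<in>kernel ?G integer_group p. \<forall>n. g \<in> word_ball ?X n \<longrightarrow> g \<in> nprod L (C * (n + 1))"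
      by (rule kernel_linear[OF X _ ab]) (use c in blast)+
    then obtain C L where
      lin: "\<And>g n. g \<in> kernel ?G integer_group p \<Longrightarrow> g \<in> word_ball ?X n \<Longrightarrow> g \<in> nprod L (C * (n + 1))"
      by blast
    have fg: "finite_gen_set ?G N (nball L)"
      unfolding assms(5) by (rule finite_gen_set_nball[OF lin])
    have "\<exists>C'. \<forall>h\<in>N. word_length ?G T h \<le> C' * (word_length ?G S h + 1) ^ 1"
    proof (rule transfer_bound[OF X_closed finite_X generate_X fg])
      show "h \<in> word_ball (nball L) (C * (n + 1) ^ 1)" if "h \<in> N" "h \<in> word_ball ?X n" for h n
        using lin[of h n] that unfolding assms(5) nprod_def by simp
    qed
    then obtain C' where "\<forall>h\<in>N. word_length ?G T h \<le> C' * (word_length ?G S h + 1)" by auto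
    then show ?thesis by (intro linear_growth_distortion) blast
  qed
  have lower: "quadratic_growth (distortion ?G S N T)"
    if nz: "\<forall>v\<in>pverts \<Gamma>. p (gen v) \<noteq> 0" and nj: "\<not> is_join \<Gamma>"
      and ST: "finite_gen_set ?G (carrier ?G) S" "finite_gen_set ?G N T" for S T
  proof -
    interpret fg_subgroup ?G S N T using ST N by unfold_locales
    have TN: "T \<subseteq> kernel ?G integer_group p"
      using ST(2) assms(5) by (simp add: finite_gen_set_def)
    obtain c a d where low: "\<And>n. \<exists>h\<in>kernel ?G integer_group p. h \<in> word_ball ?X (c * n) \<and>
      (\<forall>l. h \<in> word_ball T l \<longrightarrow> n\<^sup>2 \<le> a * l + d * n)"
    proof -
      have "\<exists>c a d. \<forall>n. \<exists>h\<in>kernel ?G integer_group p. h \<in> word_ball ?X (c * n) \<and>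
          (\<forall>l. h \<in> word_ball T l \<longrightarrow> n\<^sup>2 \<le> a * l + d * n)"
        by (rule kernel_lower_bound[OF nj assms(3) _ finite_T TN]) (use nz in blast)+
      then show thesis using that by blast
    qed
    \<comment> \<open>The lower bound already concerns words over the given \<open>T\<close>; only
      the length in the whole group has to be moved from the vertex generators to
      \<open>S\<close>.\<close>
    have "?X \<subseteq> generate ?G S" using X_closed generate_S by simp
    then have "\<exists>k. \<forall>n. word_ball ?X n \<subseteq> word_ball S (k * n)"
      by (rule word_ball_change_generators[OF S_closed finite_X]) blast
    then obtain k where k: "\<And>n. word_ball ?X n \<subseteq> word_ball S (k * n)" by blast
    obtain C where C: "\<forall>h\<in>N. word_length ?G T h \<le> C * (word_length ?G S h + 1)\<^sup>2"
      using upper[OF ST] by blast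
    show ?thesis
    proof (rule quadratic_growth_distortion)
      show "word_length ?G T h \<le> C * (word_length ?G S h + 1)\<^sup>2" if "h \<in> N" for h
        using C that by blast
      show "\<exists>h\<in>N. word_length ?G S h \<le> (k * c) * n \<and> n\<^sup>2 \<le> a * word_length ?G T h + d * n" for n
      proof -
        obtain h where h: "h \<in> N" "h \<in> word_ball ?X (c * n)"
          "\<And>l. h \<in> word_ball T l \<Longrightarrow> n\<^sup>2 \<le> a * l + d * n"
          using low[of n] assms(5) by blast
        have "h \<in> word_ball S (k * (c * n))" using k h(2) by blast
        then have "word_length ?G S h \<le> k * (c * n)" using lenS_le_iff h(1) N by blast
        moreover have "h \<in> word_ball T (word_length ?G T h)" using lenT_le_iff[OF h(1)] by blast
        ultimately show ?thesis using h by (auto simp: mult.assoc)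
      qed
    qed
  qed
  show ?thesis using fg quadratic linear lower by blast
qed

end
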